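(* For all $q\in\mathbf{C}$ with $|q|<1$, $$\frac{\varepsilon_{3}}{\varepsilon_{1}}=9\mathcal{P}-8\mathcal{E},\qquad \frac{\varepsilon_{5}}{\varepsilon_{1}}=135\mathcal{P}^{2}-240\mathcal{P}\mathcal{E}+64\mathcal{E}^{2}+42\mathcal{Q}.$$ Moreover, for each integer $n\ge 0$, there exist integers $K_{ijkl}$ (independent of $q$) such that $$\frac{\varepsilon_{2n+1}}{\varepsilon_{1}}=\sum_{\substack{i,j,k,l\ge 0\\ 2i+2j+4k+6l=2n}}K_{ijkl}\,\mathcal{P}^{i}\mathcal{E}^{j}\mathcal{Q}^{k}\mathcal{R}^{l}.$$
   Context: Throughout $q\in\mathbf{C}$ with $|q|<1$. For $n\ge 0$ let $\varepsilon_{n}(q)=\sum_{k=-\infty}^{\infty}(6k+1)^{n}q^{k(3k+1)/2}$. For $n\ge1$ let $\widetilde{\sigma}_{s}(n)=\sum_{d\mid n}(-1)^{d-1}d^{s}$ and $\widehat{\sigma}_{s}(n)=\sum_{d\mid n}(-1)^{n/d-1}d^{s}$, with $\widetilde{\sigma}=\widetilde{\sigma}_{1}$, $\widehat{\sigma}=\widehat{\sigma}_{1}$, and set $\widetilde{\sigma}(0)=\tfrac18$, $\widehat{\sigma}(0)=\tfrac1{24}$, $\widetilde{\sigma}_{3}(0)=-\tfrac1{16}$, $\widetilde{\sigma}_{5}(0)=\tfrac18$. Define $$\mathcal{P}(q)=\sum_{n=0}^{\infty}8\widetilde{\sigma}(n)q^{n},\quad \mathcal{E}(q)=\sum_{n=0}^{\infty}24\widehat{\sigma}(n)q^{n},\quad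 \mathcal{Q}(q)=\sum_{n=0}^{\infty}(-16\widetilde{\sigma}_{3}(n))q^{n},\quad \mathcal{R}(q)=\sum_{n=0}^{\infty}8\widetilde{\sigma}_{5}(n)q^{n}.$$ In the claim, $\varepsilon_n,\mathcal{P},\mathcal{E},\mathcal{Q},\mathcal{R}$ stand for their values at $q$. *)

theory Defs
  imports "HOL-Analysis.Analysis"
begin

text \<open>The exponent \<open>k (3 k + 1) / 2\<close> is always a nonnegative integer, so the conversion to
  \<^typ>\<open>nat\<close> and the division are exact. The bilateral series converges absolutely for
  \<open>norm q < 1\<close>, hence the unordered sum \<^const>\<open>infsum\<close> is its usual value.\<close>

definition epsilon :: "nat \<Rightarrow> complex \<Rightarrow> complex" where
  "epsilon n q = (\<Sum>\<^sub>\<infinity>k\<in>(UNIV :: int set). of_int ((6 * k + 1) ^ n) * q ^ nat (k * (3 * k + 1) div 2))"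

text \<open>The values at \<open>n = 0\<close> are conventions, chosen so that the series below have constant
  term 1. They are prescribed only for \<open>s = 1, 3, 5\<close> (respectively \<open>s = 1\<close>); the value 0 for
  other \<open>s\<close> is a filler that is never used.\<close>

definition sigma_tilde :: "nat \<Rightarrow> nat \<Rightarrow> complex" where
  "sigma_tilde s n =
     (if n = 0 then (if s = 1 then 1 / 8 else if s = 3 then - 1 / 16 else if s = 5 then 1 / 8 else 0)
      else (\<Sum>d | d dvd n. (- 1) ^ (d - 1) * of_nat d ^ s))"

definition sigma_hat :: "nat \<Rightarrow> nat \<Rightarrow> complex" where
  "sigma_hat s n =
     (if n = 0 then (if s = 1 then 1 / 24 else 0)
      else (\<Sum>d | d dvd n. (- 1) ^ (n div d - 1) * of_nat d ^ s))"

definition P_series :: "complex \<Rightarrow> complex" where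
  "P_series q = (\<Sum>n. 8 * sigma_tilde 1 n * q ^ n)"

definition E_series :: "complex \<Rightarrow> complex" where
  "E_series q = (\<Sum>n. 24 * sigma_hat 1 n * q ^ n)"

definition Q_series :: "complex \<Rightarrow> complex" where
  "Q_series q = (\<Sum>n. - 16 * sigma_tilde 3 n * q ^ n)"

definition R_series :: "complex \<Rightarrow> complex" where
  "R_series q = (\<Sum>n. 8 * sigma_tilde 5 n * q ^ n)"

end

theory Submission
  imports Defs "HOL-Complex_Analysis.Complex_Analysis" "HOL-Real_Asymp.Real_Asymp"
begin

text \<open>
Since \<open>24 \<cdot> k (3 k + 1) / 2 + 1 = (6 k + 1)\<^sup>2\<close>, the operator \<open>D = q d/dq\<close> satisfies
\<open>\<epsilon>\<^sub>n\<^sub>+\<^sub>2 = (24 D + 1) \<epsilon>\<^sub>n\<close>. Hence everything follows from \<open>\<epsilon>\<^sub>3 = (9 P - 8 E) \<epsilon>\<^sub>1\<close> and the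
differential equations \<open>4 D P = P\<^sup>2 - Q\<close>, \<open>2 D E = P E - Q\<close>, \<open>D Q = Q (P - E)\<close>, by which \<open>24 D\<close> maps
integral polynomials in \<open>P, E, Q\<close> to such polynomials, raising the weight. The series \<open>R\<close> is not
needed, since in fact \<open>R = E Q\<close>.

The differential equations are identities between Lambert series with \<open>u\<^sub>n = q\<^sup>n / (1 - q\<^sup>n)\<close>. They
come, as in Ramanujan's treatment, from \<open>u\<^sub>a u\<^sub>b = u\<^sub>a\<^sub>+\<^sub>b (1 + u\<^sub>a + u\<^sub>b)\<close>.

For \<open>\<epsilon>\<^sub>3\<close>, the product of the series \<open>\<Sum> (-1)\<^sup>k q\<^bsup>k(k+1)/2\<^esup> z\<^sup>k\<close> and \<open>\<Sum> (-1)\<^sup>l q\<^bsup>l\<^sup>2\<^esup> z\<^bsup>2l\<^esup>\<close> equals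
\<open>\<Sum> q\<^bsup>k(3k+1)/2\<^esup> (z\<^bsup>3k\<^esup> - z\<^bsup>-3k-1\<^esup>)\<close> up to a factor independent of \<open>z\<close>. Comparing the first and the third
moments at \<open>z = 1\<close> expresses \<open>\<epsilon>\<^sub>3 / \<epsilon>\<^sub>1\<close> by the corresponding ratios for the two theta series, which
are Lambert series. No infinite product enters.
\<close>

subsection \<open>Summability against geometric decay\<close>

text \<open>Two series have to be cancelled, \<open>pent0\<close> and \<open>epsilon 1\<close>;
  product formulas would show at once that neither vanishes on the disc. In their absence
  \<open>pent0\<close> is cancelled only near 0, where it is close to 1, and the identity theorem
  extends the formula for \<open>epsilon 3\<close> to the whole disc. That formula is in turn a
  linear differential equation for \<open>epsilon 1\<close>, and it forbids zeros. All identities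
  therefore keep the form \<open>epsilon r = f * epsilon 1\<close> until the last proof. On such
  products 24 D + 1 acts as f -> 24 D f + (9 P - 8 E) f, the map that the induction iterates. The
  Lambert identities use signed kernels (-1)^(a+b) g(a, b) with g one of (a - b)^2, (a - b)^4, a b,
  a b (a - b)^2. The sums over u_a u_b then factor into products of Lambert series, and derivatives
  arise only from u_a^2 on the diagonal. The two theta ratios come from the logarithmic derivative
  of the Jacobi triple product, proved coefficient by coefficient from recurrences.\<close>

lemma abs_summable_on_times:
  fixes f :: "'a \<Rightarrow> 'c :: real_normed_field" and g :: "'b \<Rightarrow> 'c"
  assumes "(\<lambda>x. norm (f x)) summable_on A" "(\<lambda>y. norm (g y)) summable_on B"
  shows "(\<lambda>(x, y). norm (f x * g y)) summable_on A \<times> B"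
proof (rule summable_on_SigmaI)
  show "((\<lambda>y. case (x, y) of (x, y) \<Rightarrow> norm (f x * g y)) has_sum norm (f x) * (\<Sum>\<^sub>\<infinity>y\<in>B. norm (g y))) B" for x
    using has_sum_cmult_right[OF has_sum_infsum[OF assms(2)], of "norm (f x)"] by (simp add: norm_mult)
  show "(\<lambda>x. norm (f x) * (\<Sum>\<^sub>\<infinity>y\<in>B. norm (g y))) summable_on A"
    by (intro summable_on_cmult_left assms)
qed auto

lemma
  fixes f :: "'a \<Rightarrow> complex" and g :: "'b \<Rightarrow> complex"
  assumes "f summable_on A" "g summable_on B"
  shows summable_on_times: "(\<lambda>(x, y). f x * g y) summable_on A \<times> B"
    and infsum_times: "(\<Sum>\<^sub>\<infinity>(x, y)\<in>A \<times> B. f x * g y) = infsum f A * infsum g B"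
proof -
  show s: "(\<lambda>(x, y). f x * g y) summable_on A \<times> B"
    using abs_summable_on_times[of f A g B] assms
    by (simp add: summable_on_iff_abs_summable_on_complex case_prod_unfold)
  show "(\<Sum>\<^sub>\<infinity>(x, y)\<in>A \<times> B. f x * g y) = infsum f A * infsum g B"
    by (subst infsum_Sigma_banach[OF s, symmetric])
      (simp add: infsum_cmult_right' infsum_cmult_left')
qed

lemma summable_on_bound:
  fixes f :: "'a \<Rightarrow> complex"
  assumes "g summable_on A" "\<And>x. x \<in> A \<Longrightarrow> norm (f x) \<le> g x"
  shows "f summable_on A"
proof (rule abs_summable_summable)
  show "(\<lambda>x. norm (f x)) summable_on A"
    by (rule summable_on_comparison_test[OF assms(1)]) (use assms in auto)
qed

text \<open>A weight on \<open>A\<close> is \<^emph>\<open>tame\<close> if polynomials in it are summable against every geometric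
  decay; all series below are absolutely convergent for this reason.\<close>

definition tame :: "('a \<Rightarrow> nat) \<Rightarrow> 'a set \<Rightarrow> bool" where
  "tame w A \<longleftrightarrow> (\<forall>(r::real) d. 0 \<le> r \<longrightarrow> r < 1 \<longrightarrow> (\<lambda>x. real (w x) ^ d * r ^ w x) summable_on A)"

lemma tame_subset: "tame w A \<Longrightarrow> B \<subseteq> A \<Longrightarrow> tame w B"
  unfolding tame_def by (meson summable_on_subset_banach)

lemma tame_nat: "tame (\<lambda>n. n) A"
  unfolding tame_def
proof (intro allI impI)
  fix r :: real and d :: nat
  assume r: "0 \<le> r" "r < 1"
  have "summable (\<lambda>n. real n ^ d * r ^ n)"
  proof (cases "r = 0")
    case True
    then show ?thesis by (intro summable_finite[of "{0}"]) auto
  next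
    case False
    with r have "r > 0" by simp
    have "(\<lambda>n. real n ^ d * r ^ n) \<in> O(\<lambda>n. 1 / real n ^ 2)"
      using \<open>r > 0\<close> \<open>r < 1\<close> by real_asymp
    moreover have "summable (\<lambda>n. norm (1 / real n ^ 2))"
      using inverse_power_summable[of 2, where ?'a = real] by (simp add: field_simps)
    ultimately show ?thesis by (rule summable_comparison_test_bigo[rotated])
  qed
  then have "(\<lambda>n. real n ^ d * r ^ n) summable_on UNIV"
    using r by (intro norm_summable_imp_summable_on) simp
  then show "(\<lambda>n. real n ^ d * r ^ n) summable_on A"
    by (rule summable_on_subset_banach) simp
qed

lemma one_plus_power_le: "(1 + real n) ^ d \<le> 2 ^ d * (1 + real n ^ d)"
proof (cases "n = 0")
  case False
  have "(1 + real n) ^ d \<le> (2 * real n) ^ d" by (rule power_mono) (use False in auto)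
  also have "\<dots> \<le> 2 ^ d * (1 + real n ^ d)" by (simp add: power_mult_distrib)
  finally show ?thesis .
qed (use one_le_power[of "2::real" d] in \<open>cases d; simp\<close>)

lemma tame_shifted:
  assumes "tame w A" "0 \<le> r" "r < 1"
  shows "(\<lambda>x. (1 + real (w x)) ^ d * r ^ w x) summable_on A"
proof (rule summable_on_comparison_test)
  show "(\<lambda>x. 2 ^ d * (real (w x) ^ 0 * r ^ w x + real (w x) ^ d * r ^ w x)) summable_on A"
    using assms unfolding tame_def by (intro summable_on_cmult_right summable_on_add) blast+
  fix x
  show "(1 + real (w x)) ^ d * r ^ w x \<le> 2 ^ d * (real (w x) ^ 0 * r ^ w x + real (w x) ^ d * r ^ w x)"
    using mult_right_mono[OF one_plus_power_le[of "w x" d], of "r ^ w x"] assms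
    by (simp add: algebra_simps)
qed (use assms in auto)

text \<open>The estimate w + v <= (1 + w) (1 + v) separates the variables; this is why shifted
  weights are used.\<close>

lemma tame_prod:
  assumes "tame w A" "tame v B"
  shows "tame (\<lambda>(x, y). w x + v y) (A \<times> B)"
  unfolding tame_def
proof (intro allI impI)
  fix r :: real and d :: nat
  assume r: "0 \<le> r" "r < 1"
  show "(\<lambda>z. real (case z of (x, y) \<Rightarrow> w x + v y) ^ d * r ^ (case z of (x, y) \<Rightarrow> w x + v y))
      summable_on A \<times> B"
  proof (rule summable_on_comparison_test)
    show "(\<lambda>(x, y). norm (((1 + real (w x)) ^ d * r ^ w x) * ((1 + real (v y)) ^ d * r ^ v y)))
        summable_on A \<times> B"
      using tame_shifted[OF assms(1) r, of d] tame_shifted[OF assms(2) r, of d] r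
      by (intro abs_summable_on_times) simp_all
  next
    fix z assume "z \<in> A \<times> B"
    obtain x y where z: "z = (x, y)" by (cases z)
    have "(real (w x) + real (v y)) ^ d \<le> ((1 + real (w x)) * (1 + real (v y))) ^ d"
      by (rule power_mono) (auto simp: algebra_simps)
    then have "(real (w x) + real (v y)) ^ d * r ^ (w x + v y)
        \<le> ((1 + real (w x)) * (1 + real (v y))) ^ d * r ^ (w x + v y)"
      using r by (intro mult_right_mono) auto
    then show "real (case z of (x, y) \<Rightarrow> w x + v y) ^ d * r ^ (case z of (x, y) \<Rightarrow> w x + v y)
      \<le> (case z of (x, y) \<Rightarrow> norm (((1 + real (w x)) ^ d * r ^ w x) * ((1 + real (v y)) ^ d * r ^ v y)))"
      using r by (simp add: z power_mult_distrib power_add abs_mult mult_ac)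
  qed (use r in auto)
qed

lemma tame_int: "tame (\<lambda>k::int. nat \<bar>k\<bar>) A"
proof -
  have "tame (\<lambda>k::int. nat \<bar>k\<bar>) UNIV"
    unfolding tame_def
  proof (intro allI impI)
    fix r :: real and d :: nat
    assume r: "0 \<le> r" "r < 1"
    let ?f = "\<lambda>n. real n ^ d * r ^ n"
    have "?f summable_on {1..}" "?f summable_on UNIV"
      using tame_nat r unfolding tame_def by blast+
    moreover have "(\<lambda>k::int. ?f (nat \<bar>k\<bar>)) summable_on {0..} \<longleftrightarrow> ?f summable_on UNIV"
      by (rule summable_on_reindex_bij_witness[where i = int and j = nat]) auto
    moreover have "(\<lambda>k::int. ?f (nat \<bar>k\<bar>)) summable_on {..<0} \<longleftrightarrow> ?f summable_on {1..}"
      by (rule summable_on_reindex_bij_witness[where i = "\<lambda>n. - int n" and j = "\<lambda>k. nat (-k)"]) auto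
    ultimately have "(\<lambda>k::int. ?f (nat \<bar>k\<bar>)) summable_on ({0..} \<union> {..<0})"
      by (intro summable_on_Un_disjoint) auto
    moreover have "{0..} \<union> {..<0} = (UNIV :: int set)" by auto
    ultimately show "(\<lambda>k::int. ?f (nat \<bar>k\<bar>)) summable_on UNIV" by simp
  qed
  then show ?thesis by (rule tame_subset) simp
qed

lemma tame_summable:
  fixes f :: "'a \<Rightarrow> complex"
  assumes "tame w A" "0 \<le> r" "r < 1" "\<And>x. x \<in> A \<Longrightarrow> norm (f x) \<le> C * ((1 + real (w x)) ^ d * r ^ w x)"
  shows "f summable_on A"
  by (rule summable_on_bound[OF summable_on_cmult_right[OF tame_shifted[OF assms(1-3)]] assms(4)])

text \<open>An exponent e may dominate only half of the weight n, so the decay rate passes to the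
  square root: |q|^e = sqrt(|q|)^(2e) <= s^(2e+1) / s for s between sqrt |q| and 1. Choosing s
  strictly above sqrt |q| keeps it positive at q = 0.\<close>

lemma geometric_gap:
  assumes "norm (q::complex) < 1"
  obtains s :: real where "0 < s" "s < 1" "norm q < s" "\<And>n e. n \<le> 2 * e + 1 \<Longrightarrow> norm q ^ e \<le> s ^ n / s"
proof -
  define s where "s = (1 + sqrt (norm q)) / 2"
  have sq: "sqrt (norm q) < 1" using assms by (simp add: real_sqrt_lt_1_iff)
  have s: "0 < s" "s < 1" "sqrt (norm q) \<le> s" using sq by (simp_all add: s_def field_simps add_pos_nonneg)
  have "norm q \<le> sqrt (norm q)"
    using assms sq by (metis abs_of_nonneg less_imp_le mult_left_le norm_ge_zero real_sqrt_ge_zero real_sqrt_mult_self)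
  also have "\<dots> < s" using sq by (simp add: s_def)
  finally have "norm q < s" .
  moreover have "norm q ^ e \<le> s ^ n / s" if "n \<le> 2 * e + 1" for n e
  proof -
    have "norm q ^ e = sqrt (norm q) ^ (2 * e)" by (simp add: power_mult)
    also have "\<dots> \<le> s ^ (2 * e)" using s by (intro power_mono) auto
    also have "\<dots> = s ^ (2 * e + 1) / s" using s by simp
    also have "\<dots> \<le> s ^ n / s" using s that by (intro divide_right_mono power_decreasing) auto
    finally show ?thesis .
  qed
  ultimately show ?thesis using that s by blast
qed

text \<open>The common convergence test. The bound \<open>w x \<le> 2 * e x + 1\<close> fits every
  exponent that occurs: |k| against triangular, square and pentagonal numbers, and m + n against m
  n.\<close>

lemma tame_power_series_summable:
  assumes "tame w A" "norm q < 1" "\<And>x. x \<in> A \<Longrightarrow> w x \<le> 2 * e x + 1"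
    and "\<And>x. x \<in> A \<Longrightarrow> norm (c x) \<le> C * (1 + real (w x)) ^ d"
  shows "(\<lambda>x. c x * q ^ e x :: complex) summable_on A"
proof -
  obtain s :: real where s: "0 < s" "s < 1" "\<And>n e. n \<le> 2 * e + 1 \<Longrightarrow> norm q ^ e \<le> s ^ n / s"
    using geometric_gap[OF assms(2)] by metis
  show ?thesis
  proof (rule tame_summable[OF assms(1), of s _ "C / s" d])
    fix x assume x: "x \<in> A"
    have "norm (c x * q ^ e x) \<le> (C * (1 + real (w x)) ^ d) * (s ^ w x / s)"
      unfolding norm_mult norm_power
      by (intro mult_mono s assms x order_trans[OF norm_ge_zero assms(4)]) auto
    then show "norm (c x * q ^ e x) \<le> C / s * ((1 + real (w x)) ^ d * s ^ w x)"
      by (simp add: mult_ac)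
  qed (use s in auto)
qed

text \<open>The sum is unordered over an arbitrary index set, so its partial sums form a net. By the
  M-test they converge uniformly near q, and uniform limits of holomorphic functions along a filter
  may be differentiated termwise. The Euler operator q d/dq is thus available without arranging the
  terms into a power series.\<close>

lemma
  fixes c :: "'a \<Rightarrow> complex" and e :: "'a \<Rightarrow> nat"
  assumes summ: "\<And>q :: complex. norm q < 1 \<Longrightarrow> (\<lambda>x. c x * q ^ e x) summable_on A"
  defines "f \<equiv> (\<lambda>q. \<Sum>\<^sub>\<infinity>x\<in>A. c x * q ^ e x)"
  shows series_holomorphic: "f holomorphic_on ball 0 1"
    and series_euler_deriv: "norm q < 1 \<Longrightarrow> ((\<lambda>x. c x * of_nat (e x) * q ^ e x) has_sum q * deriv f q) A"
proof -
  have *: "\<exists>D. (f has_field_derivative D) (at q) \<and> ((\<lambda>x. c x * of_nat (e x) * q ^ e x) has_sum q * D) A"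
    if q: "norm q < 1" for q
  proof -
    define r where "r = (1 - norm q) / 2"
    have r: "0 < r" "norm q + r < 1" using q by (auto simp: r_def field_simps)
    let ?F = "\<lambda>X z. \<Sum>x\<in>X. c x * z ^ e x" and ?F' = "\<lambda>X z. \<Sum>x\<in>X. c x * (of_nat (e x) * z ^ (e x - 1))"
    \<comment> \<open>The real point |q| + r still lies in the disc and supplies a majorant on the
      closed disc of radius r about q.\<close>
    have "(\<lambda>x. norm (c x) * (norm q + r) ^ e x) summable_on A"
      using summ[of "of_real (norm q + r)"] r
      by (simp add: summable_on_iff_abs_summable_on_complex norm_mult norm_power del: of_real_add)
    then have ul: "uniform_limit (cball q r) ?F f (finite_subsets_at_top A)"
      unfolding f_def
    proof (rule Weierstrass_m_test_general[rotated])
      fix x z assume "z \<in> cball q r"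
      then have "norm z \<le> norm q + r"
        using norm_triangle_sub[of z q] by (simp add: dist_norm norm_minus_commute)
      then show "norm (c x * z ^ e x) \<le> norm (c x) * (norm q + r) ^ e x"
        by (simp add: norm_mult norm_power mult_left_mono power_mono)
    qed
    have ev: "\<forall>\<^sub>F X in finite_subsets_at_top A. continuous_on (cball q r) (?F X) \<and>
        (\<forall>z\<in>ball q r. (?F X has_field_derivative ?F' X z) (at z))"
      by (intro always_eventually allI conjI ballI continuous_intros)
         (auto intro!: derivative_eq_intros sum.cong)
    obtain f' where f': "\<And>w. w \<in> ball q r \<Longrightarrow> (f has_field_derivative f' w) (at w) \<and>
        ((\<lambda>X. ?F' X w) \<longlongrightarrow> f' w) (finite_subsets_at_top A)"
      by (rule has_complex_derivative_uniform_limit[OF ev ul _ r(1)]) (auto simp: )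
    have D: "(f has_field_derivative f' q) (at q)" "((\<lambda>x. c x * (of_nat (e x) * q ^ (e x - 1))) has_sum f' q) A"
      using f'[of q] r by (auto simp: has_sum_def)
    \<comment> \<open>The factor q repairs the truncated exponent \<open>e x - 1\<close>; where
      \<open>e x = 0\<close> the term is killed by \<open>of_nat (e x)\<close>.\<close>
    from has_sum_cmult_right[OF D(2), of q]
    have "((\<lambda>x. c x * of_nat (e x) * q ^ e x) has_sum q * f' q) A"
    proof (rule iffD1[OF has_sum_cong, rotated])
      show "q * (c x * (of_nat (e x) * q ^ (e x - 1))) = c x * of_nat (e x) * q ^ e x" for x
        by (cases "e x") auto
    qed
    with D show ?thesis by blast
  qed
  then show "f holomorphic_on ball 0 1"
  proof (subst holomorphic_on_open, simp, intro ballI)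
    show "\<exists>D. (f has_field_derivative D) (at x)" if "x \<in> ball 0 1" for x
      using *[of x] that by auto
  qed
  show "((\<lambda>x. c x * of_nat (e x) * q ^ e x) has_sum q * deriv f q) A" if "norm q < 1"
    using *[OF that] DERIV_imp_deriv by blast
qed

subsection \<open>Double sums of geometric quotients\<close>

lemma has_sum_diff:
  fixes f g :: "'a \<Rightarrow> complex"
  assumes "(f has_sum a) A" "(g has_sum b) A"
  shows "((\<lambda>x. f x - g x) has_sum a - b) A"
  using has_sum_add[OF assms(1) has_sum_uminusI[OF assms(2)]] by simp

abbreviation pos :: "nat set" where "pos \<equiv> {1..}"

lemma infsum_pairs_swap:
  "(\<Sum>\<^sub>\<infinity>(a, b)\<in>A \<times> A. h a b) = (\<Sum>\<^sub>\<infinity>(a, b)\<in>A \<times> A. h b a)"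
  by (rule infsum_reindex_bij_witness[where i = prod.swap and j = prod.swap]) auto

text \<open>Off the diagonal the larger index is written as a + b, so that u_(a+b) appears and
  \<open>geo_mult\<close> applies.\<close>

lemma infsum_pairs_diagonal:
  fixes h :: "nat \<Rightarrow> nat \<Rightarrow> complex"
  assumes "(\<lambda>(a, b). h a b) summable_on pos \<times> pos"
  shows "(\<Sum>\<^sub>\<infinity>(a, b)\<in>pos \<times> pos. h a b) = (\<Sum>\<^sub>\<infinity>a\<in>pos. h a a)
    + (\<Sum>\<^sub>\<infinity>(a, b)\<in>pos \<times> pos. h a (a + b)) + (\<Sum>\<^sub>\<infinity>(a, b)\<in>pos \<times> pos. h (a + b) a)"
proof -
  let ?D = "(\<lambda>a. (a, a)) ` pos" and ?L = "{(a, b). 1 \<le> a \<and> a < b}" and ?G = "{(a, b). 1 \<le> b \<and> b < (a::nat)}"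
  let ?h = "\<lambda>(a, b). h a b"
  have part: "pos \<times> pos = ?D \<union> (?L \<union> ?G)" by force
  have s: "?h summable_on ?D" "?h summable_on ?L" "?h summable_on ?G" "?h summable_on (?L \<union> ?G)"
    by (rule summable_on_subset_banach[OF assms]; auto)+
  have "infsum ?h (pos \<times> pos) = infsum ?h ?D + (infsum ?h ?L + infsum ?h ?G)"
    unfolding part by (subst infsum_Un_disjoint[OF s(1,4)], force, subst infsum_Un_disjoint[OF s(2,3)]) auto
  moreover have "infsum ?h ?D = (\<Sum>\<^sub>\<infinity>a\<in>pos. h a a)"
    by (subst infsum_reindex) (auto simp: inj_on_def o_def)
  moreover have "(\<Sum>\<^sub>\<infinity>(a, b)\<in>pos \<times> pos. h a (a + b)) = infsum ?h ?L"
    by (rule infsum_reindex_bij_witness[where i = "\<lambda>(a, c). (a, c - a)" and j = "\<lambda>(a, b). (a, a + b)"]) auto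
  moreover have "(\<Sum>\<^sub>\<infinity>(a, b)\<in>pos \<times> pos. h (a + b) a) = infsum ?h ?G"
    by (rule infsum_reindex_bij_witness[where i = "\<lambda>(c, a). (a, c - a)" and j = "\<lambda>(a, b). (a + b, a)"]) auto
  ultimately show ?thesis by simp
qed

lemma summable_on_pairs_diagonal:
  fixes h :: "nat \<Rightarrow> nat \<Rightarrow> complex"
  assumes "(\<lambda>(a, b). h a b) summable_on A \<times> A"
  shows "(\<lambda>a. h a a) summable_on A"
proof -
  have "(\<lambda>(a, b). h a b) summable_on (\<lambda>a. (a, a)) ` A"
    by (rule summable_on_subset_banach[OF assms]) auto
  then show ?thesis by (subst (asm) summable_on_reindex) (auto simp: inj_on_def o_def)
qed

text \<open>Collecting pairs by n = a + b leaves finite inner sums, which have closed forms for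
  polynomial kernels.\<close>

lemma has_sum_pairs_antidiagonal:
  fixes h :: "nat \<Rightarrow> nat \<Rightarrow> complex"
  assumes "(\<lambda>(a, b). h a (a + b)) summable_on pos \<times> pos"
  shows "((\<lambda>n. \<Sum>a\<in>{1..<n}. h a n) has_sum (\<Sum>\<^sub>\<infinity>(a, b)\<in>pos \<times> pos. h a (a + b))) pos"
proof (rule has_sum_SigmaD)
  have "((\<lambda>(a, b). h a (a + b)) has_sum (\<Sum>\<^sub>\<infinity>(a, b)\<in>pos \<times> pos. h a (a + b))) (pos \<times> pos) \<longleftrightarrow>
    ((\<lambda>(n, a). h a n) has_sum (\<Sum>\<^sub>\<infinity>(a, b)\<in>pos \<times> pos. h a (a + b))) (SIGMA n:pos. {1..<n})"
    by (rule has_sum_reindex_bij_witness[where i = "\<lambda>(n, a). (a, n - a)" and j = "\<lambda>(a, b). (a + b, a)"]) auto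
  then show "((\<lambda>(n, a). h a n) has_sum (\<Sum>\<^sub>\<infinity>(a, b)\<in>pos \<times> pos. h a (a + b))) (SIGMA n:pos. {1..<n})"
    using has_sum_infsum[OF assms] by blast
  show "((\<lambda>a. case (n, a) of (n, a) \<Rightarrow> h a n) has_sum (\<Sum>a\<in>{1..<n}. h a n)) {1..<n}" for n
    by (intro has_sum_finiteI) auto
qed

section \<open>Geometric quotients and the kernel identity\<close>

definition geo :: "complex \<Rightarrow> nat \<Rightarrow> complex" where
  "geo q n = q ^ n / (1 - q ^ n)"

lemma power_neq_1: "norm (q::complex) < 1 \<Longrightarrow> n \<ge> 1 \<Longrightarrow> q ^ n \<noteq> 1"
  by (metis norm_one norm_power not_one_le_zero power_eq_1_iff less_irrefl norm_ge_zero)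

lemma geo_mult:
  assumes "norm q < 1" "a \<ge> 1" "b \<ge> 1"
  shows "geo q a * geo q b = geo q (a + b) * (1 + geo q a + geo q b)"
proof -
  have "1 - q ^ a \<noteq> 0" "1 - q ^ b \<noteq> 0" "1 - q ^ a * q ^ b \<noteq> 0"
    using power_neq_1[OF assms(1)] assms(2,3) by (auto simp flip: power_add)
  then show ?thesis
    unfolding geo_def power_add by (simp add: divide_simps) (simp add: algebra_simps)
qed

lemma norm_geo_le:
  assumes "norm q < 1" "n \<ge> 1"
  shows "norm (geo q n) \<le> norm q ^ n / (1 - norm q)"
proof -
  have "1 - norm q \<le> 1 - norm q ^ n"
    using assms power_decreasing[of 1 n "norm q"] by simp
  also have "\<dots> \<le> norm (1 - q ^ n)"
    using norm_triangle_ineq2[of 1 "q ^ n"] by (simp add: norm_power)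
  finally show ?thesis
    unfolding geo_def norm_divide norm_power using assms by (intro divide_left_mono) (auto intro!: mult_pos_pos)
qed

lemma norm_geo_le_const:
  assumes "norm q < 1" "n \<ge> 1"
  shows "norm (geo q n) \<le> 1 / (1 - norm q)"
  using norm_geo_le[OF assms] assms(1)
  by (meson diff_gt_0_iff_gt divide_right_mono less_imp_le norm_ge_zero order_trans power_le_one)

lemma tame_pairs: "tame (\<lambda>(a, b). a + b) (A \<times> B :: (nat \<times> nat) set)"
  using tame_prod[OF tame_nat tame_nat] .

text \<open>One majorant for all double sums of the kernel identity: the arguments of f are linear
  forms such as (a, a + b), of total size at most 2 (a + b), and g is a product of geometric
  quotients.\<close>

lemma pairs_summable:
  fixes f :: "int \<Rightarrow> int \<Rightarrow> complex"
  assumes q: "norm q < 1" and f: "\<And>a b. norm (f a b) \<le> C * (1 + real_of_int (\<bar>a\<bar> + \<bar>b\<bar>)) ^ d"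
    and xy: "\<And>a b. \<bar>x a b\<bar> + \<bar>y a b\<bar> \<le> 2 * (int a + int b)"
    and g: "\<And>a b. a \<ge> 1 \<Longrightarrow> b \<ge> 1 \<Longrightarrow> norm (g a b) \<le> K * norm q ^ (a + b)"
  shows "(\<lambda>(a, b). f (x a b) (y a b) * g a b) summable_on pos \<times> pos"
proof (rule tame_summable[OF tame_pairs, where r = "norm q" and C = "C * 2 ^ d * K" and d = d])
  fix z assume "z \<in> pos \<times> pos"
  then obtain a b where z: "z = (a, b)" "a \<ge> 1" "b \<ge> 1" by auto
  have "0 \<le> C" using order_trans[OF norm_ge_zero f[of 0 0]] by simp
  have "norm (f (x a b) (y a b)) \<le> C * (1 + real_of_int (\<bar>x a b\<bar> + \<bar>y a b\<bar>)) ^ d" by (rule f)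
  also have "\<dots> \<le> C * (2 * (1 + real (a + b))) ^ d"
  proof -
    have "real_of_int (\<bar>x a b\<bar> + \<bar>y a b\<bar>) \<le> real_of_int (2 * (int a + int b))"
      using xy[of a b] by (simp only: of_int_le_iff)
    then have "1 + real_of_int (\<bar>x a b\<bar> + \<bar>y a b\<bar>) \<le> 2 * (1 + real (a + b))" by simp
    then show ?thesis using \<open>0 \<le> C\<close> by (intro mult_left_mono power_mono) auto
  qed
  finally have "norm (f (x a b) (y a b)) \<le> C * 2 ^ d * (1 + real (a + b)) ^ d"
    by (simp only: power_mult_distrib mult.assoc)
  then have "norm (f (x a b) (y a b) * g a b) \<le> (C * 2 ^ d * (1 + real (a + b)) ^ d) * (K * norm q ^ (a + b))"
    unfolding norm_mult using g[OF z(2,3)] by (intro mult_mono) (auto intro: order_trans[OF norm_ge_zero])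
  then show "norm (case z of (a, b) \<Rightarrow> f (x a b) (y a b) * g a b)
    \<le> C * 2 ^ d * K * ((1 + real (case z of (a, b) \<Rightarrow> a + b)) ^ d * norm q ^ (case z of (a, b) \<Rightarrow> a + b))"
    by (simp add: z mult_ac)
qed (use q in auto)

text \<open>The partial fraction identity \<open>u\<^sub>a u\<^sub>b = u\<^sub>a\<^sub>+\<^sub>b (1 + u\<^sub>a + u\<^sub>b)\<close> for
  \<open>u\<^sub>n = q\<^sup>n / (1 - q\<^sup>n)\<close> makes all double sums with two different weights telescope.\<close>

lemma geo_kernel:
  fixes f :: "int \<Rightarrow> int \<Rightarrow> complex"
  assumes q: "norm q < 1"
    and sym: "\<And>a b. f b a = f a b" and neg: "\<And>a b. f (- a) (- b) = f a b"
    and f: "\<And>a b. norm (f a b) \<le> C * (1 + real_of_int (\<bar>a\<bar> + \<bar>b\<bar>)) ^ d"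
  shows "(\<Sum>\<^sub>\<infinity>(a, b)\<in>pos \<times> pos.
        (f (int a) (int b) - f (int a) (- int b) - 2 * f (int b) (int a + int b) + 2 * f (int b) (int b - int a))
        * (geo q a * geo q b))
    = (\<Sum>\<^sub>\<infinity>a\<in>pos. (f (int a) (int a) + 2 * f (int a) 0) * geo q a ^ 2)
      - (\<Sum>\<^sub>\<infinity>n\<in>pos. (\<Sum>a\<in>{1..<n}. 2 * f (int a) (int n) + f (int a) (int a - int n)) * geo q n)"
proof -
  let ?u = "geo q" and ?r = "norm q"
  define c where "c = 1 / (1 - norm q)"
  have c1: "1 \<le> c" using q by (simp add: c_def)
  have u: "norm (?u n) \<le> c * ?r ^ n" "norm (?u n) \<le> c" if "n \<ge> 1" for n
    using norm_geo_le[OF q that] norm_geo_le_const[OF q that] by (simp_all add: c_def)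
  have r1: "?r ^ n \<le> 1" for n using q by (simp add: power_le_one)
  \<comment> \<open>A factor u_(a+b) decays fast enough alone, so its partner is merely bounded by
    c; in u_a u_b both factors contribute to the decay.\<close>
  have uu: "norm (?u a * ?u b) \<le> c ^ 2 * ?r ^ (a + b)"
      "norm (?u a * ?u (a + b)) \<le> c ^ 2 * ?r ^ (a + b)"
      "norm (?u b * ?u (a + b)) \<le> c ^ 2 * ?r ^ (a + b)"
      "norm (?u (a + b)) \<le> c * ?r ^ (a + b)" if ab: "a \<ge> 1" "b \<ge> 1" for a b
  proof -
    show "norm (?u a * ?u b) \<le> c ^ 2 * ?r ^ (a + b)"
      using mult_mono[OF u(1)[OF ab(1)] u(1)[OF ab(2)]] c1
      by (simp add: norm_mult power_add power2_eq_square mult_ac)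
    show ub: "norm (?u (a + b)) \<le> c * ?r ^ (a + b)" using u(1)[of "a + b"] ab by simp
    show "norm (?u a * ?u (a + b)) \<le> c ^ 2 * ?r ^ (a + b)"
      using mult_mono[OF u(2)[OF ab(1)] ub] c1
      by (simp add: norm_mult power2_eq_square mult_ac)
    show "norm (?u b * ?u (a + b)) \<le> c ^ 2 * ?r ^ (a + b)"
      using mult_mono[OF u(2)[OF ab(2)] ub] c1
      by (simp add: norm_mult power2_eq_square mult_ac)
  qed
  note summ = pairs_summable[OF q f]
  \<comment> \<open>A, B, V, Y run over u_a u_b; X, Z, W over u_(a+b) times another quotient; T and
    T' over u_(a+b) alone. The facts X', Y', Z', W' restate the same sums after swapping a and b or
    using the symmetries of f.\<close>
  define S where "S h = (\<Sum>\<^sub>\<infinity>(a, b)\<in>pos \<times> pos. h a b :: complex)" for h :: "nat \<Rightarrow> nat \<Rightarrow> complex"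
  define A where "A = S (\<lambda>a b. f (int a) (int b) * (?u a * ?u b))"
  define B where "B = S (\<lambda>a b. f (int a) (- int b) * (?u a * ?u b))"
  define V where "V = S (\<lambda>a b. f (int b) (int b - int a) * (?u a * ?u b))"
  define X where "X = S (\<lambda>a b. f (int a) (int a + int b) * (?u a * ?u (a + b)))"
  define Y where "Y = S (\<lambda>a b. f (int a) (int a + int b) * (?u a * ?u b))"
  define Z where "Z = S (\<lambda>a b. f (int a) (int a + int b) * (?u b * ?u (a + b)))"
  define T where "T = S (\<lambda>a b. f (int a) (int a + int b) * ?u (a + b))"
  define T' where "T' = S (\<lambda>a b. f (int a) (- int b) * ?u (a + b))"
  define W where "W = S (\<lambda>a b. f (int a) (- int b) * (?u a * ?u (a + b)))"
  have Y': "Y = S (\<lambda>a b. f (int b) (int a + int b) * (?u a * ?u b))"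
    unfolding Y_def S_def by (subst infsum_pairs_swap) (simp add: add_ac mult_ac)
  have Z': "Z = S (\<lambda>a b. f (int a + int b) (int b) * (?u a * ?u (a + b)))"
    unfolding Z_def S_def by (subst infsum_pairs_swap) (simp add: add_ac mult_ac sym)
  have X': "X = S (\<lambda>a b. f (int a + int b) (int a) * (?u (a + b) * ?u a))"
    unfolding X_def S_def by (simp add: mult_ac sym)
  have W': "W = S (\<lambda>a b. f (int a) (- int b) * (?u b * ?u (a + b)))"
  proof -
    have *: "f (- int a) (int b) = f (int a) (- int b)" for a b using neg[of "int a" "- int b"] by simp
    show ?thesis unfolding W_def S_def by (subst infsum_pairs_swap, subst sym) (simp add: add_ac *)
  qed
  have hs: "((\<lambda>(a, b). f (int a) (int b) * (?u a * ?u b)) has_sum A) (pos \<times> pos)"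
      "((\<lambda>(a, b). f (int a) (- int b) * (?u a * ?u b)) has_sum B) (pos \<times> pos)"
      "((\<lambda>(a, b). f (int b) (int b - int a) * (?u a * ?u b)) has_sum V) (pos \<times> pos)"
      "((\<lambda>(a, b). f (int a) (int a + int b) * (?u a * ?u b)) has_sum Y) (pos \<times> pos)"
      "((\<lambda>(a, b). f (int a) (int a + int b) * (?u b * ?u (a + b))) has_sum Z) (pos \<times> pos)"
      "((\<lambda>(a, b). f (int a) (int a + int b) * ?u (a + b)) has_sum T) (pos \<times> pos)"
      "((\<lambda>(a, b). f (int a) (- int b) * ?u (a + b)) has_sum T') (pos \<times> pos)"
      "((\<lambda>(a, b). f (int a) (- int b) * (?u a * ?u (a + b))) has_sum W) (pos \<times> pos)"
    unfolding A_def B_def V_def Y_def Z_def T_def T'_def W_def S_def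
    by (rule has_sum_infsum, rule summ, simp, erule (1) uu)+
  have hsY: "((\<lambda>(a, b). f (int b) (int a + int b) * (?u a * ?u b)) has_sum Y) (pos \<times> pos)"
    unfolding Y' S_def by (rule has_sum_infsum, rule summ, simp, erule (1) uu)
  have hsW: "((\<lambda>(a, b). f (int a) (- int b) * (?u b * ?u (a + b))) has_sum W) (pos \<times> pos)"
    unfolding W' S_def by (rule has_sum_infsum, rule summ, simp, erule (1) uu)
  define D where "D = (\<Sum>\<^sub>\<infinity>a\<in>pos. f (int a) (int a) * ?u a ^ 2)"
  define D0 where "D0 = (\<Sum>\<^sub>\<infinity>a\<in>pos. f (int a) 0 * ?u a ^ 2)"
  have hsD: "((\<lambda>a. f (int a) (int a) * ?u a ^ 2) has_sum D) pos"
    using summable_on_pairs_diagonal[OF has_sum_imp_summable[OF hs(1)]]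
    unfolding D_def by (intro has_sum_infsum) (simp add: power2_eq_square)
  have hsD0: "((\<lambda>a. f (int a) 0 * ?u a ^ 2) has_sum D0) pos"
    using summable_on_pairs_diagonal[OF has_sum_imp_summable[OF hs(3)]]
    unfolding D0_def by (intro has_sum_infsum) (simp add: power2_eq_square)
  have "A = D + S (\<lambda>a b. f (int a) (int a + int b) * (?u a * ?u (a + b)))
      + S (\<lambda>a b. f (int a + int b) (int a) * (?u (a + b) * ?u a))"
    using infsum_pairs_diagonal[OF has_sum_imp_summable[OF hs(1)]]
    by (simp add: A_def D_def S_def power2_eq_square)
  then have A: "A = D + 2 * X"
    unfolding X_def[symmetric] X'[symmetric] by simp
  have V: "V = D0 + Z + W"
    using infsum_pairs_diagonal[OF has_sum_imp_summable[OF hs(3)]]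
    by (simp add: V_def D0_def S_def Z' W_def power2_eq_square mult_ac)
  have "((\<lambda>(a, b). f (int a) (int a + int b) * (?u a * ?u (a + b))) has_sum Y - Z - T) (pos \<times> pos)"
  proof (rule iffD1[OF has_sum_cong has_sum_diff[OF has_sum_diff[OF hs(4,5)] hs(6)]])
    fix z assume "z \<in> pos \<times> pos"
    then obtain a b where z: "z = (a, b)" "a \<ge> 1" "b \<ge> 1" by auto
    show "(case z of (a, b) \<Rightarrow> f (int a) (int a + int b) * (?u a * ?u b))
        - (case z of (a, b) \<Rightarrow> f (int a) (int a + int b) * (?u b * ?u (a + b)))
        - (case z of (a, b) \<Rightarrow> f (int a) (int a + int b) * ?u (a + b))
        = (case z of (a, b) \<Rightarrow> f (int a) (int a + int b) * (?u a * ?u (a + b)))"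
      using geo_mult[OF q z(2,3)] by (simp add: z(1)) (simp add: algebra_simps)
  qed
  then have X: "X = Y - Z - T"
    unfolding X_def S_def by (rule infsumI)
  have "((\<lambda>(a, b). f (int a) (- int b) * (?u a * ?u b)) has_sum T' + W + W) (pos \<times> pos)"
  proof (rule iffD1[OF has_sum_cong has_sum_add[OF has_sum_add[OF hs(7,8)] hsW]])
    fix z assume "z \<in> pos \<times> pos"
    then obtain a b where z: "z = (a, b)" "a \<ge> 1" "b \<ge> 1" by auto
    show "(case z of (a, b) \<Rightarrow> f (int a) (- int b) * ?u (a + b))
        + (case z of (a, b) \<Rightarrow> f (int a) (- int b) * (?u a * ?u (a + b)))
        + (case z of (a, b) \<Rightarrow> f (int a) (- int b) * (?u b * ?u (a + b)))
        = (case z of (a, b) \<Rightarrow> f (int a) (- int b) * (?u a * ?u b))"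
      using geo_mult[OF q z(2,3)] by (simp add: z(1)) (simp add: algebra_simps)
  qed
  then have B: "B = T' + W + W"
    unfolding B_def S_def by (rule infsumI)
  have "(\<Sum>\<^sub>\<infinity>(a, b)\<in>pos \<times> pos.
        (f (int a) (int b) - f (int a) (- int b) - 2 * f (int b) (int a + int b) + 2 * f (int b) (int b - int a))
        * (?u a * ?u b)) = A - B - 2 * Y + 2 * V"
    by (rule infsumI, rule iffD1[OF has_sum_cong has_sum_add[OF has_sum_diff[OF has_sum_diff[OF hs(1,2)]
          has_sum_cmult_right[OF hsY, of 2]] has_sum_cmult_right[OF hs(3), of 2]]])
       (auto simp: algebra_simps)
  \<comment> \<open>The coefficients 1, -1, -2, 2 are those for which Y, Z and W cancel: 2 X = 2 Y -
    2 Z - 2 T meets -2 Y, and 2 V = 2 D0 + 2 Z + 2 W meets the 2 W in B.\<close>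
  also have "\<dots> = (D + 2 * D0) - (2 * T + T')"
    unfolding A V X B by simp
  also have "D + 2 * D0 = (\<Sum>\<^sub>\<infinity>a\<in>pos. (f (int a) (int a) + 2 * f (int a) 0) * ?u a ^ 2)"
    by (rule infsumI[symmetric], rule iffD1[OF has_sum_cong has_sum_add[OF hsD has_sum_cmult_right[OF hsD0, of 2]]])
       (auto simp: algebra_simps)
  also have "2 * T + T' = (\<Sum>\<^sub>\<infinity>n\<in>pos. (\<Sum>a\<in>{1..<n}. 2 * f (int a) (int n) + f (int a) (int a - int n)) * ?u n)"
  proof (rule infsumI[symmetric])
    have "((\<lambda>n. \<Sum>a\<in>{1..<n}. f (int a) (int n) * ?u n) has_sum T) pos"
      using has_sum_pairs_antidiagonal[of "\<lambda>a n. f (int a) (int n) * ?u n"] has_sum_imp_summable[OF hs(6)]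
      by (simp add: T_def S_def)
    moreover have "((\<lambda>n. \<Sum>a\<in>{1..<n}. f (int a) (int a - int n) * ?u n) has_sum T') pos"
      using has_sum_pairs_antidiagonal[of "\<lambda>a n. f (int a) (int a - int n) * ?u n"] has_sum_imp_summable[OF hs(7)]
      by (simp add: T'_def S_def)
    ultimately have "((\<lambda>n. 2 * (\<Sum>a\<in>{1..<n}. f (int a) (int n) * ?u n)
        + (\<Sum>a\<in>{1..<n}. f (int a) (int a - int n) * ?u n)) has_sum 2 * T + T') pos"
      by (intro has_sum_add has_sum_cmult_right)
    then show "((\<lambda>n. (\<Sum>a\<in>{1..<n}. 2 * f (int a) (int n) + f (int a) (int a - int n)) * ?u n) has_sum 2 * T + T') pos"
      by (simp add: sum.distrib sum_distrib_left sum_distrib_right algebra_simps)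
  qed
  finally show ?thesis .
qed

subsection \<open>Lambert series\<close>

definition lambert :: "complex \<Rightarrow> nat \<Rightarrow> complex \<Rightarrow> complex" where
  "lambert x s = (\<lambda>q. \<Sum>\<^sub>\<infinity>(m, n)\<in>pos \<times> pos. x ^ m * of_nat m ^ s * q ^ (m * n))"

lemma add_le_double_mult: "m \<ge> 1 \<Longrightarrow> n \<ge> 1 \<Longrightarrow> m + n \<le> 2 * (m * n) + (1::nat)"
  by (cases m; cases n) auto

lemma lambert_summable:
  fixes x q :: complex
  assumes "norm x \<le> 1" "norm q < 1"
  shows "(\<lambda>(m, n). x ^ m * of_nat m ^ s * q ^ (m * n)) summable_on pos \<times> pos"
proof -
  have "(\<lambda>p. (x ^ fst p * of_nat (fst p) ^ s) * q ^ (fst p * snd p)) summable_on pos \<times> pos"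
  proof (rule tame_power_series_summable[OF tame_pairs assms(2), where C = 1 and d = s])
    fix p :: "nat \<times> nat" assume p: "p \<in> pos \<times> pos"
    show "(case p of (a, b) \<Rightarrow> a + b) \<le> 2 * (fst p * snd p) + 1"
      using p add_le_double_mult by auto
    have "norm x ^ fst p * real (fst p) ^ s \<le> 1 * (1 + real (fst p + snd p)) ^ s"
      using assms by (intro mult_mono power_mono power_le_one) auto
    then show "norm (x ^ fst p * of_nat (fst p) ^ s) \<le> 1 * (1 + real (case p of (a, b) \<Rightarrow> a + b)) ^ s"
      by (simp add: norm_mult norm_power case_prod_unfold)
  qed
  then show ?thesis by (simp add: case_prod_unfold)
qed

lemma
  assumes x: "norm x \<le> 1"
  shows lambert_holomorphic: "lambert x s holomorphic_on ball 0 1"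
    and lambert_euler_deriv: "norm q < 1 \<Longrightarrow>
      ((\<lambda>(m, n). x ^ m * of_nat m ^ Suc s * (of_nat n * q ^ (m * n))) has_sum q * deriv (lambert x s) q) (pos \<times> pos)"
proof -
  have eq: "lambert x s = (\<lambda>q. \<Sum>\<^sub>\<infinity>p\<in>pos \<times> pos. (case p of (m, n) \<Rightarrow> x ^ m * of_nat m ^ s) * q ^ (case p of (m, n) \<Rightarrow> m * n))"
    unfolding lambert_def by (simp add: case_prod_unfold)
  have s: "(\<lambda>p. (case p of (m, n) \<Rightarrow> x ^ m * of_nat m ^ s) * q ^ (case p of (m, n) \<Rightarrow> m * n)) summable_on pos \<times> pos"
    if "norm q < 1" for q
    using lambert_summable[OF x that] by (simp add: case_prod_unfold)
  show "lambert x s holomorphic_on ball 0 1"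
    unfolding eq by (rule series_holomorphic[OF s])
  assume "norm q < 1"
  then show "((\<lambda>(m, n). x ^ m * of_nat m ^ Suc s * (of_nat n * q ^ (m * n))) has_sum q * deriv (lambert x s) q) (pos \<times> pos)"
    using series_euler_deriv[OF s, of q] unfolding eq by (simp add: case_prod_unfold mult_ac)
qed

lemma has_sum_geo:
  assumes "norm (q::complex) < 1" "m \<ge> 1"
  shows "((\<lambda>n. q ^ (m * n)) has_sum geo q m) pos"
    and "((\<lambda>n. of_nat n * q ^ (m * n)) has_sum geo q m + geo q m ^ 2) pos"
proof -
  define y where "y = q ^ m"
  have y: "norm y < 1" "y \<noteq> 1"
    using assms power_neq_1 power_less_one_iff[of "norm q" m] by (auto simp: y_def norm_power)
  show "((\<lambda>n. q ^ (m * n)) has_sum geo q m) pos"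
    using has_sum_geometric_from_1[of y] y by (simp add: power_mult y_def geo_def)
  have "(\<lambda>n. of_nat (Suc n) * y ^ n) sums (1 / (1 - y)\<^sup>2)"
    by (rule geometric_deriv_sums[OF y(1)])
  moreover have "summable (\<lambda>n. norm (of_nat (Suc n) * y ^ n))"
    using geometric_deriv_sums[of "norm y"] y by (simp add: norm_mult norm_power sums_iff del: of_nat_Suc)
  ultimately have "((\<lambda>n. of_nat (Suc n) * y ^ n) has_sum (1 / (1 - y)\<^sup>2)) UNIV"
    by (rule norm_summable_imp_has_sum[rotated])
  then have "((\<lambda>n. y * (of_nat (Suc n) * y ^ n)) has_sum y * (1 / (1 - y)\<^sup>2)) UNIV"
    by (rule has_sum_cmult_right)
  moreover have "((\<lambda>n. y * (of_nat (Suc n) * y ^ n)) has_sum y * (1 / (1 - y)\<^sup>2)) UNIV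
      \<longleftrightarrow> ((\<lambda>n. of_nat n * y ^ n) has_sum y * (1 / (1 - y)\<^sup>2)) pos"
    by (rule has_sum_reindex_bij_witness[where i = "\<lambda>n. n - 1" and j = Suc]) auto
  moreover have "y * (1 / (1 - y)\<^sup>2) = geo q m + geo q m ^ 2"
  proof -
    have "1 - y \<noteq> 0" using y(2) by simp
    then show ?thesis
      unfolding geo_def y_def[symmetric] by (simp add: divide_simps power2_eq_square) (simp add: algebra_simps)
  qed
  ultimately show "((\<lambda>n. of_nat n * q ^ (m * n)) has_sum geo q m + geo q m ^ 2) pos"
    by (simp add: power_mult y_def)
qed

lemma lambert_geo:
  assumes "norm x \<le> 1" "norm q < 1"
  shows "((\<lambda>m. x ^ m * of_nat m ^ s * geo q m) has_sum lambert x s q) pos"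
proof (rule has_sum_SigmaD)
  show "((\<lambda>(m, n). x ^ m * of_nat m ^ s * q ^ (m * n)) has_sum lambert x s q) (pos \<times> pos)"
    unfolding lambert_def by (intro has_sum_infsum lambert_summable assms)
  show "((\<lambda>n. case (m, n) of (m, n) \<Rightarrow> x ^ m * of_nat m ^ s * q ^ (m * n)) has_sum x ^ m * of_nat m ^ s * geo q m) pos"
    if "m \<in> pos" for m
    using has_sum_geo(1)[OF assms(2), of m] that by (auto intro!: has_sum_cmult_right)
qed

text \<open>With u = y / (1 - y) one has sum n y^n = y / (1 - y)^2 = u + u^2. So the Euler operator
  replaces u_m by m (u_m + u_m^2); this turns the diagonal of the kernel identity into a
  derivative.\<close>

lemma lambert_geo_square:
  assumes "norm x \<le> 1" "norm q < 1"
  shows "((\<lambda>m. x ^ m * of_nat m ^ Suc s * geo q m ^ 2) has_sum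
    q * deriv (lambert x s) q - lambert x (Suc s) q) pos"
proof -
  have "((\<lambda>m. x ^ m * of_nat m ^ Suc s * (geo q m + geo q m ^ 2)) has_sum q * deriv (lambert x s) q) pos"
  proof (rule has_sum_SigmaD[OF lambert_euler_deriv[OF assms]])
    show "((\<lambda>n. case (m, n) of (m, n) \<Rightarrow> x ^ m * of_nat m ^ Suc s * (of_nat n * q ^ (m * n)))
        has_sum x ^ m * of_nat m ^ Suc s * (geo q m + geo q m ^ 2)) pos"
      if "m \<in> pos" for m
      using has_sum_geo(2)[OF assms(2), of m] that by (auto intro!: has_sum_cmult_right)
  qed
  from has_sum_diff[OF this lambert_geo[OF assms, of "Suc s"]] show ?thesis
    by (rule iffD1[OF has_sum_cong, rotated]) (simp add: algebra_simps)
qed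

lemma lambert_times:
  assumes "norm x \<le> 1" "norm y \<le> 1" "norm q < 1"
  shows "((\<lambda>(a, b). x ^ a * of_nat a ^ s * (y ^ b * of_nat b ^ t) * (geo q a * geo q b))
    has_sum lambert x s q * lambert y t q) (pos \<times> pos)"
proof -
  note s = has_sum_imp_summable[OF lambert_geo[OF assms(1,3), of s]] has_sum_imp_summable[OF lambert_geo[OF assms(2,3), of t]]
  have "((\<lambda>(a, b). (x ^ a * of_nat a ^ s * geo q a) * (y ^ b * of_nat b ^ t * geo q b))
    has_sum lambert x s q * lambert y t q) (pos \<times> pos)"
    using has_sum_infsum[OF summable_on_times[OF s]] infsum_times[OF s]
      infsumI[OF lambert_geo[OF assms(1,3), of s]] infsumI[OF lambert_geo[OF assms(2,3), of t]] by simp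
  then show ?thesis by (simp add: case_prod_unfold mult_ac)
qed

section \<open>Signs and finite alternating sums\<close>

definition par :: "int \<Rightarrow> complex" where "par a = (if even a then 1 else - 1)"

lemma par_simps [simp]:
  "par 0 = 1" "par (a + b) = par a * par b" "par (a - b) = par a * par b" "par (- a) = par a"
  "par (int n) = (- 1) ^ n" "par a * par a = 1" "norm (par a) = 1"
  by (auto simp: par_def)

text \<open>The induction starts at n = 1: at n = 0 the first closed form would give -1 for an empty
  sum.\<close>

lemma alternating_power_sums:
  fixes n :: nat
  assumes "n \<ge> 1"
  defines "e \<equiv> (- 1) ^ n :: complex" and "N \<equiv> of_nat n :: complex"
  shows "(\<Sum>a\<in>{1..<n}. (- 1) ^ a) = (- e - 1) / 2"
    and "(\<Sum>a\<in>{1..<n}. (- 1) ^ a * of_nat a) = (- e * (2 * N - 1) - 1) / 4"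
    and "(\<Sum>a\<in>{1..<n}. (- 1) ^ a * of_nat a ^ 2) = - e * N * (N - 1) / 2"
    and "(\<Sum>a\<in>{1..<n}. (- 1) ^ a * of_nat a ^ 3) = (- e * (4 * N ^ 3 - 6 * N ^ 2 + 1) + 1) / 8"
    and "(\<Sum>a\<in>{1..<n}. (- 1) ^ a * of_nat a ^ 4) = - e * (N ^ 4 - 2 * N ^ 3 + N) / 2"
    and "(\<Sum>a\<in>{1..<n}. of_nat a) = N * (N - 1) / 2"
    and "(\<Sum>a\<in>{1..<n}. of_nat a ^ 2) = N * (N - 1) * (2 * N - 1) / 6"
  using assms(1) unfolding e_def N_def
  by (induction n rule: nat_induct_at_least; simp add: field_simps power2_eq_square power3_eq_cube power4_eq_xxxx)+

text \<open>The inner sums of the kernel identity for (a - b)^2, (a - b)^4, a b and a b (a - b)^2,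
  in this order, with the sign (-1)^(a+b). At the arguments (a, a - n) the sign no longer depends on
  a, so each sum is an alternating part plus a plain power sum.\<close>

lemma kernel_finite_sums:
  fixes n :: nat
  assumes "n \<ge> 1"
  defines "e \<equiv> (- 1) ^ n :: complex" and "N \<equiv> of_nat n :: complex"
  shows "(\<Sum>a\<in>{1..<n}. 2 * (e * (- 1) ^ a * (of_nat a - N) ^ 2) + e * N ^ 2) = e * (N ^ 3 - 2 * N ^ 2 + N)"
    and "(\<Sum>a\<in>{1..<n}. 2 * (e * (- 1) ^ a * (of_nat a - N) ^ 4) + e * N ^ 4)
      = e * (N ^ 5 - 2 * N ^ 4 + 2 * N ^ 3 - N)"
    and "(\<Sum>a\<in>{1..<n}. 2 * (e * (- 1) ^ a * (of_nat a * N)) + e * (of_nat a * (of_nat a - N)))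
      = - (N ^ 2) + N / 2 - e * N / 2 - e * (N ^ 3 - N) / 6"
    and "(\<Sum>a\<in>{1..<n}. 2 * (e * (- 1) ^ a * (of_nat a * N * (of_nat a - N) ^ 2)) + e * (of_nat a * (of_nat a - N) * N ^ 2))
      = e * (- (N ^ 3) / 2 + N / 4 - (N ^ 5 - N ^ 3) / 6) - N / 4"
proof -
  note p = alternating_power_sums[OF assms(1), folded e_def N_def]
  have e: "e = 1 \<or> e = - 1" by (cases "even n") (simp_all add: e_def)
  have c: "(\<Sum>a\<in>{1..<n}. k) = (N - 1) * k" for k :: complex
    using assms(1) by (simp add: N_def of_nat_diff)
  have "(\<Sum>a\<in>{1..<n}. 2 * (e * (- 1) ^ a * (of_nat a - N) ^ 2) + e * N ^ 2)
      = (\<Sum>a\<in>{1..<n}. 2 * e * ((- 1) ^ a * of_nat a ^ 2) - 4 * e * N * ((- 1) ^ a * of_nat a)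
        + 2 * e * N ^ 2 * (- 1) ^ a + e * N ^ 2)"
    by (intro sum.cong refl) (simp add: algebra_simps power2_eq_square)
  also have "\<dots> = e * (N ^ 3 - 2 * N ^ 2 + N)"
    unfolding sum.distrib sum_subtractf sum_distrib_left[symmetric] p c using e by (elim disjE; simp add: field_simps eval_nat_numeral)
  finally show "(\<Sum>a\<in>{1..<n}. 2 * (e * (- 1) ^ a * (of_nat a - N) ^ 2) + e * N ^ 2) = e * (N ^ 3 - 2 * N ^ 2 + N)" .
  have "(\<Sum>a\<in>{1..<n}. 2 * (e * (- 1) ^ a * (of_nat a - N) ^ 4) + e * N ^ 4)
      = (\<Sum>a\<in>{1..<n}. 2 * e * ((- 1) ^ a * of_nat a ^ 4) - 8 * e * N * ((- 1) ^ a * of_nat a ^ 3)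
        + 12 * e * N ^ 2 * ((- 1) ^ a * of_nat a ^ 2) - 8 * e * N ^ 3 * ((- 1) ^ a * of_nat a)
        + 2 * e * N ^ 4 * (- 1) ^ a + e * N ^ 4)"
    by (intro sum.cong refl) (simp add: algebra_simps power2_eq_square power3_eq_cube power4_eq_xxxx)
  also have "\<dots> = e * (N ^ 5 - 2 * N ^ 4 + 2 * N ^ 3 - N)"
    unfolding sum.distrib sum_subtractf sum_distrib_left[symmetric] p c using e by (elim disjE; simp add: field_simps eval_nat_numeral)
  finally show "(\<Sum>a\<in>{1..<n}. 2 * (e * (- 1) ^ a * (of_nat a - N) ^ 4) + e * N ^ 4)
      = e * (N ^ 5 - 2 * N ^ 4 + 2 * N ^ 3 - N)" .
  have "(\<Sum>a\<in>{1..<n}. 2 * (e * (- 1) ^ a * (of_nat a * N)) + e * (of_nat a * (of_nat a - N)))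
      = (\<Sum>a\<in>{1..<n}. 2 * e * N * ((- 1) ^ a * of_nat a) + e * of_nat a ^ 2 - e * N * of_nat a)"
    by (intro sum.cong refl) (simp add: algebra_simps power2_eq_square)
  also have "\<dots> = - (N ^ 2) + N / 2 - e * N / 2 - e * (N ^ 3 - N) / 6"
    unfolding sum.distrib sum_subtractf sum_distrib_left[symmetric] p c using e by (elim disjE; simp add: field_simps eval_nat_numeral)
  finally show "(\<Sum>a\<in>{1..<n}. 2 * (e * (- 1) ^ a * (of_nat a * N)) + e * (of_nat a * (of_nat a - N)))
      = - (N ^ 2) + N / 2 - e * N / 2 - e * (N ^ 3 - N) / 6" .
  have "(\<Sum>a\<in>{1..<n}. 2 * (e * (- 1) ^ a * (of_nat a * N * (of_nat a - N) ^ 2)) + e * (of_nat a * (of_nat a - N) * N ^ 2))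
      = (\<Sum>a\<in>{1..<n}. 2 * e * N * ((- 1) ^ a * of_nat a ^ 3) - 4 * e * N ^ 2 * ((- 1) ^ a * of_nat a ^ 2)
        + 2 * e * N ^ 3 * ((- 1) ^ a * of_nat a) + e * N ^ 2 * of_nat a ^ 2 - e * N ^ 3 * of_nat a)"
    by (intro sum.cong refl) (simp add: algebra_simps power2_eq_square power3_eq_cube)
  also have "\<dots> = e * (- (N ^ 3) / 2 + N / 4 - (N ^ 5 - N ^ 3) / 6) - N / 4"
    unfolding sum.distrib sum_subtractf sum_distrib_left[symmetric] p c using e by (elim disjE; simp add: field_simps eval_nat_numeral)
  finally show "(\<Sum>a\<in>{1..<n}. 2 * (e * (- 1) ^ a * (of_nat a * N * (of_nat a - N) ^ 2)) + e * (of_nat a * (of_nat a - N) * N ^ 2))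
      = e * (- (N ^ 3) / 2 + N / 4 - (N ^ 5 - N ^ 3) / 6) - N / 4" .
qed

lemma norm_of_int_le_one_plus_abs:
  fixes a b :: int
  shows "norm (of_int a :: complex) \<le> 1 + real_of_int (\<bar>a\<bar> + \<bar>b\<bar>)" "norm (of_int b :: complex) \<le> 1 + real_of_int (\<bar>a\<bar> + \<bar>b\<bar>)"
    "norm (of_int (a - b) :: complex) \<le> 1 + real_of_int (\<bar>a\<bar> + \<bar>b\<bar>)"
  by (simp_all only: norm_of_int)

text \<open>With f(a, b) = (-1)^(a+b) g(a, b) the signs simplify: f(b, a + b) and f(b, b - a) carry
  (-1)^a, f(a, a) carries none, f(a, a - n) carries (-1)^n. Passing L, D, R and M as parameters
  reduces each instance to polynomial identities.\<close>

lemma lambert_kernel: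
  fixes g :: "int \<Rightarrow> int \<Rightarrow> complex"
  assumes "norm q < 1" and "\<And>a b. g b a = g a b" and "\<And>a b. g (- a) (- b) = g a b"
    and "\<And>a b. norm (g a b) \<le> (1 + real_of_int (\<bar>a\<bar> + \<bar>b\<bar>)) ^ d"
    and L: "((\<lambda>(a, b). ((- 1) ^ a * (- 1) ^ b * (g (int a) (int b) - g (int a) (- int b)) - 2 * (- 1) ^ a * g (int b) (int a + int b)
          + 2 * (- 1) ^ a * g (int b) (int b - int a)) * (geo q a * geo q b)) has_sum L) (pos \<times> pos)"
    and D: "((\<lambda>a. (g (int a) (int a) + 2 * (- 1) ^ a * g (int a) 0) * geo q a ^ 2) has_sum D) pos"
    and R: "\<And>n. n \<ge> 1 \<Longrightarrow> (\<Sum>a\<in>{1..<n}. 2 * ((- 1) ^ n * (- 1) ^ a * g (int a) (int n)) + (- 1) ^ n * g (int a) (int a - int n)) = R n"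
    and M: "((\<lambda>n. R n * geo q n) has_sum M) pos"
  shows "L = D - M"
proof -
  define f where "f = (\<lambda>a b. par (a + b) * g a b)"
  have [simp]: "(- 1) ^ n * ((- 1) ^ n * x) = x" for n and x :: complex by (simp flip: power_add mult.assoc)
  have "L = (\<Sum>\<^sub>\<infinity>(a, b)\<in>pos \<times> pos.
        (f (int a) (int b) - f (int a) (- int b) - 2 * f (int b) (int a + int b) + 2 * f (int b) (int b - int a))
        * (geo q a * geo q b))"
    using L by (intro infsumI[symmetric]) (simp add: f_def algebra_simps)
  also have "\<dots> = (\<Sum>\<^sub>\<infinity>a\<in>pos. (f (int a) (int a) + 2 * f (int a) 0) * geo q a ^ 2)
      - (\<Sum>\<^sub>\<infinity>n\<in>pos. (\<Sum>a\<in>{1..<n}. 2 * f (int a) (int n) + f (int a) (int a - int n)) * geo q n)"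
    by (rule geo_kernel[where C = 1 and d = d]) (use assms in \<open>auto simp: f_def norm_mult mult_ac\<close>)
  also have "(\<Sum>\<^sub>\<infinity>a\<in>pos. (f (int a) (int a) + 2 * f (int a) 0) * geo q a ^ 2) = D"
    using D by (intro infsumI) (simp add: f_def algebra_simps)
  also have "(\<Sum>\<^sub>\<infinity>n\<in>pos. (\<Sum>a\<in>{1..<n}. 2 * f (int a) (int n) + f (int a) (int a - int n)) * geo q n) = M"
  proof (rule infsumI, rule iffD2[OF has_sum_cong M])
    fix n :: nat assume "n \<in> pos"
    then have "(\<Sum>a\<in>{1..<n}. 2 * f (int a) (int n) + f (int a) (int a - int n)) = R n"
      using R[of n] by (simp add: f_def mult_ac)
    then show "(\<Sum>a\<in>{1..<n}. 2 * f (int a) (int n) + f (int a) (int a - int n)) * geo q n = R n * geo q n" by simp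
  qed
  finally show ?thesis .
qed

section \<open>Four instances of the kernel identity\<close>

context
  fixes q :: complex
  assumes q: "norm q < 1"
begin

abbreviation (input) "A1 \<equiv> lambert 1 1 q"
abbreviation (input) "B1 \<equiv> lambert (- 1) 1 q"
abbreviation (input) "B3 \<equiv> lambert (- 1) 3 q"
abbreviation (input) "B5 \<equiv> lambert (- 1) 5 q"

lemma lambert_geo_pm:
  "((\<lambda>m. of_nat m ^ s * geo q m) has_sum lambert 1 s q) pos"
  "((\<lambda>m. (- 1) ^ m * of_nat m ^ s * geo q m) has_sum lambert (- 1) s q) pos"
  using lambert_geo[of 1 q s] lambert_geo[of "- 1" q s] q by simp_all

text \<open>For an even function of a - b the last two kernel terms cancel, and (a - b)^2 - (a +
  b)^2 = -4 a b factors. The series \<open>lambert (- 1) 2\<close> enters from the diagonal as well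
  as from the finite sums and drops out.\<close>

lemma euler_deriv_lambert_m1_1: "- 4 * B1 ^ 2 = 2 * (q * deriv (lambert (- 1) 1) q) - B3 - B1"
proof -
  have "- 4 * (B1 * B1) = 2 * (q * deriv (lambert (- 1) 1) q - lambert (- 1) (Suc 1) q) - (B3 - 2 * lambert (- 1) 2 q + B1)"
  proof (rule lambert_kernel[OF q, of "\<lambda>a b. of_int (a - b) ^ 2" 2])
    show "norm (of_int (a - b) ^ 2 :: complex) \<le> (1 + real_of_int (\<bar>a\<bar> + \<bar>b\<bar>)) ^ 2" for a b
      unfolding norm_power by (intro power_mono norm_of_int_le_one_plus_abs) simp
  next
    fix n :: nat assume "n \<ge> 1"
    from kernel_finite_sums(1)[OF this]
    show "(\<Sum>a\<in>{1..<n}. 2 * ((- 1) ^ n * (- 1) ^ a * of_int ((int a) - (int n)) ^ 2) + (- 1) ^ n * of_int ((int a) - (int a - int n)) ^ 2) = ((- 1) ^ n * ((of_nat n :: complex) ^ 3 - 2 * of_nat n ^ 2 + of_nat n))"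
      by simp
  next
    show "((\<lambda>n. ((- 1) ^ n * (of_nat n ^ 3 - 2 * of_nat n ^ 2 + of_nat n)) * geo q n) has_sum B3 - 2 * lambert (- 1) 2 q + B1) pos"
    proof (rule iffD1[OF has_sum_cong, rotated])
      show "((\<lambda>n. (- 1) ^ n * of_nat n ^ 3 * geo q n - 2 * ((- 1) ^ n * of_nat n ^ 2 * geo q n) + (- 1) ^ n * of_nat n ^ 1 * geo q n) has_sum B3 - 2 * lambert (- 1) 2 q + B1) pos"
        by (intro has_sum_add has_sum_diff has_sum_cmult_right lambert_geo_pm)
    qed (simp add: field_simps)
  next
    show "((\<lambda>(a, b). ((- 1) ^ a * (- 1) ^ b * (of_int ((int a) - (int b)) ^ 2 - of_int ((int a) - (- int b)) ^ 2) - 2 * (- 1) ^ a * of_int ((int b) - (int a + int b)) ^ 2 + 2 * (- 1) ^ a * of_int ((int b) - (int b - int a)) ^ 2)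
        * (geo q a * geo q b)) has_sum - 4 * (B1 * B1)) (pos \<times> pos)"
      using has_sum_cmult_right[OF lambert_times[of "- 1" "- 1" q 1 1], of "- 4"] q
      by (simp add: case_prod_unfold power2_eq_square algebra_simps)
  next
    show "((\<lambda>a. (of_int ((int a) - (int a)) ^ 2 + 2 * (- 1) ^ a * of_int ((int a) - 0) ^ 2) * geo q a ^ 2) has_sum 2 * (q * deriv (lambert (- 1) 1) q - lambert (- 1) (Suc 1) q)) pos"
      using has_sum_cmult_right[OF lambert_geo_square[of "- 1" q 1], of 2] q
      by (simp add: power2_eq_square algebra_simps)
  qed (simp_all add: eval_nat_numeral algebra_simps)
  then show ?thesis by (simp add: eval_nat_numeral algebra_simps)
qed

text \<open>Here (a - b)^4 - (a + b)^4 = -8 (a^3 b + a b^3), and both halves sum to the same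
  product, hence the 16.\<close>

lemma euler_deriv_lambert_m1_3: "- 16 * B1 * B3 = 2 * (q * deriv (lambert (- 1) 3) q) - B5 - 2 * B3 + B1"
proof -
  have "- 16 * (B1 * B3) = 2 * (q * deriv (lambert (- 1) 3) q - lambert (- 1) (Suc 3) q) - (B5 - 2 * lambert (- 1) 4 q + 2 * B3 - B1)"
  proof (rule lambert_kernel[OF q, of "\<lambda>a b. of_int (a - b) ^ 4" 4])
    show "norm (of_int (a - b) ^ 4 :: complex) \<le> (1 + real_of_int (\<bar>a\<bar> + \<bar>b\<bar>)) ^ 4" for a b
      unfolding norm_power by (intro power_mono norm_of_int_le_one_plus_abs) simp
  next
    fix n :: nat assume "n \<ge> 1"
    from kernel_finite_sums(2)[OF this]
    show "(\<Sum>a\<in>{1..<n}. 2 * ((- 1) ^ n * (- 1) ^ a * of_int ((int a) - (int n)) ^ 4) + (- 1) ^ n * of_int ((int a) - (int a - int n)) ^ 4) = ((- 1) ^ n * ((of_nat n :: complex) ^ 5 - 2 * of_nat n ^ 4 + 2 * of_nat n ^ 3 - of_nat n))"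
      by simp
  next
    show "((\<lambda>n. ((- 1) ^ n * (of_nat n ^ 5 - 2 * of_nat n ^ 4 + 2 * of_nat n ^ 3 - of_nat n)) * geo q n) has_sum B5 - 2 * lambert (- 1) 4 q + 2 * B3 - B1) pos"
    proof (rule iffD1[OF has_sum_cong, rotated])
      show "((\<lambda>n. (- 1) ^ n * of_nat n ^ 5 * geo q n - 2 * ((- 1) ^ n * of_nat n ^ 4 * geo q n) + 2 * ((- 1) ^ n * of_nat n ^ 3 * geo q n) - (- 1) ^ n * of_nat n ^ 1 * geo q n) has_sum B5 - 2 * lambert (- 1) 4 q + 2 * B3 - B1) pos"
        by (intro has_sum_add has_sum_diff has_sum_cmult_right lambert_geo_pm)
    qed (simp add: field_simps)
  next
    show "((\<lambda>(a, b). ((- 1) ^ a * (- 1) ^ b * (of_int ((int a) - (int b)) ^ 4 - of_int ((int a) - (- int b)) ^ 4) - 2 * (- 1) ^ a * of_int ((int b) - (int a + int b)) ^ 4 + 2 * (- 1) ^ a * of_int ((int b) - (int b - int a)) ^ 4)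
        * (geo q a * geo q b)) has_sum - 16 * (B1 * B3)) (pos \<times> pos)"
      using has_sum_add[OF has_sum_cmult_right[OF lambert_times[of "- 1" "- 1" q 1 3], of "- 8"]
          has_sum_cmult_right[OF lambert_times[of "- 1" "- 1" q 3 1], of "- 8"]] q
      by (simp add: case_prod_unfold eval_nat_numeral algebra_simps)
  next
    show "((\<lambda>a. (of_int ((int a) - (int a)) ^ 4 + 2 * (- 1) ^ a * of_int ((int a) - 0) ^ 4) * geo q a ^ 2) has_sum 2 * (q * deriv (lambert (- 1) 3) q - lambert (- 1) (Suc 3) q)) pos"
      using has_sum_cmult_right[OF lambert_geo_square[of "- 1" q 3], of 2] q
      by (simp add: eval_nat_numeral algebra_simps)
  qed (simp_all add: eval_nat_numeral algebra_simps)
  then show ?thesis by (simp add: eval_nat_numeral algebra_simps)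
qed

text \<open>For the kernel a b the last two terms no longer cancel: -2 b (a + b) + 2 b (b - a) = -4
  a b with the sign (-1)^a only, which brings in the unsigned series. On the diagonal g(a, 0) = 0
  and g(a, a) = a^2 is unsigned, so the unsigned series is the one differentiated.\<close>

lemma euler_deriv_lambert_1_1: "2 * B1 ^ 2 - 4 * B1 * A1 = q * deriv (lambert 1 1) q - A1 / 2 + B1 / 3 + B3 / 6"
proof -
  have "2 * (B1 * B1) - 4 * (B1 * A1) = q * deriv (lambert 1 1) q - lambert 1 (Suc 1) q - (1 / 2 * A1 - lambert 1 2 q - 1 / 3 * B1 - 1 / 6 * B3)"
  proof (rule lambert_kernel[OF q, of "\<lambda>a b. of_int (a * b)" 2])
    show "norm (of_int (a * b) :: complex) \<le> (1 + real_of_int (\<bar>a\<bar> + \<bar>b\<bar>)) ^ 2" for a b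
      unfolding of_int_mult norm_mult power2_eq_square by (intro mult_mono norm_of_int_le_one_plus_abs) auto
  next
    fix n :: nat assume "n \<ge> 1"
    from kernel_finite_sums(3)[OF this]
    show "(\<Sum>a\<in>{1..<n}. 2 * ((- 1) ^ n * (- 1) ^ a * of_int ((int a) * (int n))) + (- 1) ^ n * of_int ((int a) * (int a - int n))) = (- ((of_nat n :: complex) ^ 2) + of_nat n / 2 - (- 1) ^ n * of_nat n / 2 - (- 1) ^ n * (of_nat n ^ 3 - of_nat n) / 6)"
      by simp
  next
    show "((\<lambda>n. (- (of_nat n ^ 2) + of_nat n / 2 - (- 1) ^ n * of_nat n / 2 - (- 1) ^ n * (of_nat n ^ 3 - of_nat n) / 6) * geo q n) has_sum 1 / 2 * A1 - lambert 1 2 q - 1 / 3 * B1 - 1 / 6 * B3) pos"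
    proof (rule iffD1[OF has_sum_cong, rotated])
      show "((\<lambda>n. 1 / 2 * (of_nat n ^ 1 * geo q n) - of_nat n ^ 2 * geo q n - 1 / 3 * ((- 1) ^ n * of_nat n ^ 1 * geo q n) - 1 / 6 * ((- 1) ^ n * of_nat n ^ 3 * geo q n)) has_sum 1 / 2 * A1 - lambert 1 2 q - 1 / 3 * B1 - 1 / 6 * B3) pos"
        by (intro has_sum_add has_sum_diff has_sum_cmult_right lambert_geo_pm)
    qed (simp add: field_simps)
  next
    show "((\<lambda>(a, b). ((- 1) ^ a * (- 1) ^ b * (of_int ((int a) * (int b)) - of_int ((int a) * (- int b))) - 2 * (- 1) ^ a * of_int ((int b) * (int a + int b)) + 2 * (- 1) ^ a * of_int ((int b) * (int b - int a)))
        * (geo q a * geo q b)) has_sum 2 * (B1 * B1) - 4 * (B1 * A1)) (pos \<times> pos)"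
      using has_sum_diff[OF has_sum_cmult_right[OF lambert_times[of "- 1" "- 1" q 1 1], of 2]
          has_sum_cmult_right[OF lambert_times[of "- 1" 1 q 1 1], of 4]] q
      by (simp add: case_prod_unfold eval_nat_numeral algebra_simps)
  next
    show "((\<lambda>a. (of_int ((int a) * (int a)) + 2 * (- 1) ^ a * of_int ((int a) * 0)) * geo q a ^ 2) has_sum q * deriv (lambert 1 1) q - lambert 1 (Suc 1) q) pos"
      using lambert_geo_square[of 1 q 1] q
      by (simp add: eval_nat_numeral algebra_simps)
  qed (simp_all add: eval_nat_numeral algebra_simps)
  then show ?thesis by (simp add: eval_nat_numeral algebra_simps)
qed

text \<open>Equivalent to \<open>R = E Q\<close>.\<close>

lemma lambert_relation: "4 * B3 * (B1 - A1) = B5 / 6 + B3 / 3 - B1 / 4 + A1 / 4"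
proof -
  have "4 * (B1 * B3) - 4 * (B3 * A1) = 0 - (1 / 4 * B1 - 1 / 3 * B3 - 1 / 6 * B5 - 1 / 4 * A1)"
  proof (rule lambert_kernel[OF q, of "\<lambda>a b. (of_int (a * b) * of_int (a - b) ^ 2)" 4])
    show "norm ((of_int (a * b) * of_int (a - b) ^ 2) :: complex) \<le> (1 + real_of_int (\<bar>a\<bar> + \<bar>b\<bar>)) ^ 4" for a b
          proof -
      let ?s = "1 + real_of_int (\<bar>a\<bar> + \<bar>b\<bar>)"
      have "norm (of_int a :: complex) * norm (of_int b :: complex) * norm (of_int (a - b) :: complex) ^ 2 \<le> ?s * ?s * ?s ^ 2"
        by (intro mult_mono power_mono norm_of_int_le_one_plus_abs) auto
      also have "\<dots> = ?s ^ 4" by (simp add: eval_nat_numeral)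
      finally show ?thesis unfolding of_int_mult norm_mult norm_power .
    qed
  next
    fix n :: nat assume "n \<ge> 1"
    from kernel_finite_sums(4)[OF this]
    show "(\<Sum>a\<in>{1..<n}. 2 * ((- 1) ^ n * (- 1) ^ a * (of_int ((int a) * (int n)) * of_int ((int a) - (int n)) ^ 2)) + (- 1) ^ n * (of_int ((int a) * (int a - int n)) * of_int ((int a) - (int a - int n)) ^ 2)) = ((- 1) ^ n * (- ((of_nat n :: complex) ^ 3) / 2 + of_nat n / 4 - (of_nat n ^ 5 - of_nat n ^ 3) / 6) - of_nat n / 4)"
      by simp
  next
    show "((\<lambda>n. ((- 1) ^ n * (- (of_nat n ^ 3) / 2 + of_nat n / 4 - (of_nat n ^ 5 - of_nat n ^ 3) / 6) - of_nat n / 4) * geo q n) has_sum 1 / 4 * B1 - 1 / 3 * B3 - 1 / 6 * B5 - 1 / 4 * A1) pos"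
    proof (rule iffD1[OF has_sum_cong, rotated])
      show "((\<lambda>n. 1 / 4 * ((- 1) ^ n * of_nat n ^ 1 * geo q n) - 1 / 3 * ((- 1) ^ n * of_nat n ^ 3 * geo q n) - 1 / 6 * ((- 1) ^ n * of_nat n ^ 5 * geo q n) - 1 / 4 * (of_nat n ^ 1 * geo q n)) has_sum 1 / 4 * B1 - 1 / 3 * B3 - 1 / 6 * B5 - 1 / 4 * A1) pos"
        by (intro has_sum_add has_sum_diff has_sum_cmult_right lambert_geo_pm)
    qed (simp add: field_simps)
  next
    show "((\<lambda>(a, b). ((- 1) ^ a * (- 1) ^ b * ((of_int ((int a) * (int b)) * of_int ((int a) - (int b)) ^ 2) - (of_int ((int a) * (- int b)) * of_int ((int a) - (- int b)) ^ 2)) - 2 * (- 1) ^ a * (of_int ((int b) * (int a + int b)) * of_int ((int b) - (int a + int b)) ^ 2) + 2 * (- 1) ^ a * (of_int ((int b) * (int b - int a)) * of_int ((int b) - (int b - int a)) ^ 2))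
        * (geo q a * geo q b)) has_sum 4 * (B1 * B3) - 4 * (B3 * A1)) (pos \<times> pos)"
      using has_sum_diff[OF has_sum_add[OF has_sum_cmult_right[OF lambert_times[of "- 1" "- 1" q 1 3], of 2]
          has_sum_cmult_right[OF lambert_times[of "- 1" "- 1" q 3 1], of 2]]
          has_sum_cmult_right[OF lambert_times[of "- 1" 1 q 3 1], of 4]] q
      by (simp add: case_prod_unfold eval_nat_numeral algebra_simps)
  next
    \<comment> \<open>The kernel a b (a - b)^2 vanishes both at b = a and at b = 0. No u_a^2 is
      left, hence no derivative, and the outcome is purely algebraic.\<close>
    show "((\<lambda>a. ((of_int ((int a) * (int a)) * of_int ((int a) - (int a)) ^ 2) + 2 * (- 1) ^ a * (of_int ((int a) * 0) * of_int ((int a) - 0) ^ 2)) * geo q a ^ 2) has_sum 0) pos"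
      by simp
  qed (simp_all add: eval_nat_numeral algebra_simps)
  then show ?thesis by (simp add: algebra_simps)
qed

end

subsection \<open>Differential equations for the three series\<close>

text \<open>Grouping the pairs (m, k) by the product n = m k makes the inner sum run over the
  divisors of n.\<close>

lemma lambert_power_series:
  assumes "norm x \<le> 1" "norm q < 1"
  shows "((\<lambda>n. (\<Sum>d | d dvd n. x ^ d * of_nat d ^ s) * q ^ n) has_sum lambert x s q) pos"
proof (rule has_sum_SigmaD)
  have "((\<lambda>(m, n). x ^ m * of_nat m ^ s * q ^ (m * n)) has_sum lambert x s q) (pos \<times> pos)"
    unfolding lambert_def by (intro has_sum_infsum lambert_summable assms)
  also have "?this \<longleftrightarrow> ((\<lambda>(n, d). x ^ d * of_nat d ^ s * q ^ n) has_sum lambert x s q) (SIGMA n:pos. {d. d dvd n})"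
    by (rule has_sum_reindex_bij_witness[where i = "\<lambda>(n, d). (d, n div d)" and j = "\<lambda>(m, k). (m * k, m)"])
       (auto elim!: dvdE simp: Suc_le_eq)
  finally show "((\<lambda>(n, d). x ^ d * of_nat d ^ s * q ^ n) has_sum lambert x s q) (SIGMA n:pos. {d. d dvd n})" .
  show "((\<lambda>d. case (n, d) of (n, d) \<Rightarrow> x ^ d * of_nat d ^ s * q ^ n) has_sum (\<Sum>d | d dvd n. x ^ d * of_nat d ^ s) * q ^ n) {d. d dvd n}"
    if "n \<in> pos" for n
    using that by (intro has_sum_finiteI) (auto simp: sum_distrib_right)
qed

text \<open>Isolates the constant term, the place where the conventional values of the divisor sums
  at 0 enter.\<close>

lemma suminf_eq_pos:
  fixes c :: "nat \<Rightarrow> complex"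
  assumes "((\<lambda>n. c n * q ^ n) has_sum S) pos"
  shows "(\<Sum>n. c n * q ^ n) = c 0 + S"
proof -
  have "((\<lambda>n. c n * q ^ n) has_sum c 0 * q ^ 0 + S) (insert 0 pos)"
    using assms by (intro has_sum_insert) auto
  moreover have "insert 0 pos = (UNIV :: nat set)" by auto
  ultimately show ?thesis using has_sum_imp_sums sums_unique by fastforce
qed

lemma sigma_tilde_pos: "n \<ge> 1 \<Longrightarrow> sigma_tilde s n = - (\<Sum>d | d dvd n. (- 1) ^ d * of_nat d ^ s)"
proof -
  assume n: "n \<ge> 1"
  have "(- 1 :: complex) ^ (d - 1) = - ((- 1) ^ d)" if "d dvd n" for d
    using that n by (cases d) auto
  then show ?thesis using n by (simp add: sigma_tilde_def sum_negf[symmetric])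
qed

text \<open>Doubling maps the divisors of n with even cofactor bijectively onto the even divisors.
  Hence \<open>sigma_hat 1 n\<close> is S - 2 T, while the sum with signs (-1)^d is 4 T - S.\<close>

lemma sigma_hat_pos:
  assumes n: "n \<ge> 1"
  shows "2 * sigma_hat 1 n = (\<Sum>d | d dvd n. of_nat d) - (\<Sum>d | d dvd n. (- 1) ^ d * of_nat d)"
proof -
  define S T :: complex where "S = (\<Sum>d | d dvd n. of_nat d)" and "T = (\<Sum>d | d dvd n \<and> even (n div d). of_nat d)"
  have fin: "finite {d. d dvd n}" using n by auto
  have T2: "2 * T = (\<Sum>d | d dvd n \<and> even d. of_nat d)"
    unfolding T_def sum_distrib_left
    by (rule sum.reindex_bij_witness[where i = "\<lambda>d. d div 2" and j = "\<lambda>d. 2 * d"])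
       (use n in \<open>auto elim!: dvdE evenE simp: mult_ac\<close>)
  have "sigma_hat 1 n = (\<Sum>d | d dvd n. of_nat d - 2 * (if even (n div d) then of_nat d else 0))"
    unfolding sigma_hat_def using n
    by (auto intro!: sum.cong simp: uminus_power_if dvd_div_eq_0_iff)
  also have "\<dots> = S - 2 * T"
    unfolding S_def T_def sum_subtractf sum_distrib_left[symmetric] using fin
    by (simp add: sum.inter_filter[symmetric])
  finally have 1: "sigma_hat 1 n = S - 2 * T" .
  have "(\<Sum>d | d dvd n. (- 1) ^ d * of_nat d) = (\<Sum>d | d dvd n. 2 * (if even d then of_nat d else 0) - of_nat d :: complex)"
    by (auto intro!: sum.cong)
  also have "\<dots> = 2 * (2 * T) - S"
    unfolding T2 S_def sum_subtractf sum_distrib_left[symmetric] using fin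
    by (simp add: sum.inter_filter[symmetric])
  finally show ?thesis unfolding 1 S_def[symmetric] by simp
qed

context
  fixes q :: complex
  assumes q: "norm q < 1"
begin

lemma P_series_lambert: "P_series q = 1 - 8 * lambert (- 1) 1 q"
proof -
  have "((\<lambda>n. 8 * sigma_tilde 1 n * q ^ n) has_sum (- 8) * lambert (- 1) 1 q) pos"
    by (rule iffD1[OF has_sum_cong has_sum_cmult_right[OF lambert_power_series[OF _ q, of "- 1" 1], of "- 8"]])
       (auto simp: sigma_tilde_pos)
  from suminf_eq_pos[OF this] show ?thesis by (simp add: P_series_def sigma_tilde_def)
qed

lemma Q_series_lambert: "Q_series q = 1 + 16 * lambert (- 1) 3 q"
proof -
  have "((\<lambda>n. - 16 * sigma_tilde 3 n * q ^ n) has_sum 16 * lambert (- 1) 3 q) pos"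
    by (rule iffD1[OF has_sum_cong has_sum_cmult_right[OF lambert_power_series[OF _ q, of "- 1" 3], of 16]])
       (auto simp: sigma_tilde_pos)
  from suminf_eq_pos[OF this] show ?thesis by (simp add: Q_series_def sigma_tilde_def)
qed

lemma E_series_lambert: "E_series q = 1 + 12 * lambert 1 1 q - 12 * lambert (- 1) 1 q"
proof -
  have "((\<lambda>n. 24 * sigma_hat 1 n * q ^ n) has_sum 12 * lambert 1 1 q - 12 * lambert (- 1) 1 q) pos"
  proof (rule iffD1[OF has_sum_cong has_sum_diff[OF has_sum_cmult_right[OF lambert_power_series[OF _ q, of 1 1], of 12]
          has_sum_cmult_right[OF lambert_power_series[OF _ q, of "- 1" 1], of 12]]])
    fix n :: nat assume "n \<in> pos"
    then have "24 * sigma_hat 1 n = 12 * (\<Sum>d | d dvd n. of_nat d) - 12 * (\<Sum>d | d dvd n. (- 1) ^ d * of_nat d)"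
      using arg_cong[OF sigma_hat_pos[of n], of "\<lambda>z. 12 * z"] by (simp add: right_diff_distrib)
    then show "12 * ((\<Sum>d | d dvd n. 1 ^ d * of_nat d ^ 1) * q ^ n) - 12 * ((\<Sum>d | d dvd n. (- 1) ^ d * of_nat d ^ 1) * q ^ n)
        = 24 * sigma_hat 1 n * q ^ n"
      by (simp add: left_diff_distrib mult.assoc)
  qed auto
  from suminf_eq_pos[OF this] show ?thesis by (simp add: E_series_def sigma_hat_def)
qed

end

section \<open>Derivatives of P, E and Q\<close>

lemma lambert_has_derivative:
  assumes "norm x \<le> 1" "norm q < 1"
  shows "(lambert x s has_field_derivative deriv (lambert x s) q) (at q)"
  using lambert_holomorphic[OF assms(1)] assms(2) by (intro holomorphic_derivI[of _ "ball 0 1"]) auto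

text \<open>The Lambert expressions are known to agree with the series inside the unit disc, which
  suffices because derivatives are local.\<close>

lemma deriv_ball_cong:
  assumes "norm q < 1" "(g has_field_derivative D) (at q)" "\<And>z. norm z < 1 \<Longrightarrow> f z = g z"
  shows "(f has_field_derivative D) (at q)"
  using assms by (intro has_field_derivative_transform_within_open[OF assms(2), of "ball 0 1"]) auto

lemma P_series_deriv:
  assumes q: "norm q < 1"
  obtains D where "(P_series has_field_derivative D) (at q)" "4 * (q * D) = P_series q ^ 2 - Q_series q"
proof
  let ?D = "deriv (lambert (- 1) 1) q"
  show "(P_series has_field_derivative - 8 * ?D) (at q)"
    by (rule deriv_ball_cong[OF q _ P_series_lambert])
       (auto intro!: derivative_eq_intros lambert_has_derivative q)
  have "2 * (q * ?D) = - 4 * lambert (- 1) 1 q ^ 2 + lambert (- 1) 3 q + lambert (- 1) 1 q"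
    using euler_deriv_lambert_m1_1[OF q] by simp
  then show "4 * (q * (- 8 * ?D)) = P_series q ^ 2 - Q_series q"
    unfolding P_series_lambert[OF q] Q_series_lambert[OF q] by algebra
qed

lemma E_series_deriv:
  assumes q: "norm q < 1"
  obtains D where "(E_series has_field_derivative D) (at q)" "2 * (q * D) = P_series q * E_series q - Q_series q"
proof
  let ?D = "deriv (lambert (- 1) 1) q" and ?D' = "deriv (lambert 1 1) q"
  show "(E_series has_field_derivative 12 * ?D' - 12 * ?D) (at q)"
    by (rule deriv_ball_cong[OF q _ E_series_lambert])
       (auto intro!: derivative_eq_intros lambert_has_derivative q)
  have "2 * (q * ?D) = - 4 * lambert (- 1) 1 q ^ 2 + lambert (- 1) 3 q + lambert (- 1) 1 q"
    using euler_deriv_lambert_m1_1[OF q] by simp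
  moreover have "6 * (q * ?D') = 12 * lambert (- 1) 1 q ^ 2 - 24 * lambert (- 1) 1 q * lambert 1 1 q
      + 3 * lambert 1 1 q - 2 * lambert (- 1) 1 q - lambert (- 1) 3 q"
    using euler_deriv_lambert_1_1[OF q] by (simp add: field_simps)
  ultimately show "2 * (q * (12 * ?D' - 12 * ?D)) = P_series q * E_series q - Q_series q"
    unfolding P_series_lambert[OF q] Q_series_lambert[OF q] E_series_lambert[OF q] by algebra
qed

lemma Q_series_deriv:
  assumes q: "norm q < 1"
  obtains D where "(Q_series has_field_derivative D) (at q)" "q * D = Q_series q * (P_series q - E_series q)"
proof
  let ?D = "deriv (lambert (- 1) 3) q"
  show "(Q_series has_field_derivative 16 * ?D) (at q)"
    by (rule deriv_ball_cong[OF q _ Q_series_lambert])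
       (auto intro!: derivative_eq_intros lambert_has_derivative q)
  have "2 * (q * ?D) = - 16 * lambert (- 1) 1 q * lambert (- 1) 3 q + lambert (- 1) 5 q
      + 2 * lambert (- 1) 3 q - lambert (- 1) 1 q"
    using euler_deriv_lambert_m1_3[OF q] by simp
  \<comment> \<open>The derivative involves \<open>lambert (- 1) 5\<close>, which occurs in none of
    P, E, Q; the algebraic relation eliminates it.\<close>
  moreover have "48 * lambert (- 1) 3 q * (lambert (- 1) 1 q - lambert 1 1 q)
      = 2 * lambert (- 1) 5 q + 4 * lambert (- 1) 3 q - 3 * lambert (- 1) 1 q + 3 * lambert 1 1 q"
    using arg_cong[OF lambert_relation[OF q], of "\<lambda>z. 12 * z"] by (simp add: algebra_simps)
  ultimately show "q * (16 * ?D) = Q_series q * (P_series q - E_series q)"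
    unfolding P_series_lambert[OF q] Q_series_lambert[OF q] E_series_lambert[OF q] by algebra
qed

subsection \<open>Theta series\<close>

lemma infsum_int_split:
  fixes h :: "int \<Rightarrow> complex"
  assumes "h summable_on UNIV"
  shows "(\<Sum>\<^sub>\<infinity>k. h k) = h j + (\<Sum>\<^sub>\<infinity>m\<in>pos. h (j + int m)) + (\<Sum>\<^sub>\<infinity>m\<in>pos. h (j - int m))"
    and "(\<lambda>m. h (j + int m)) summable_on A" and "(\<lambda>m. h (j - int m)) summable_on A"
proof -
  have s: "h summable_on {j}" "h summable_on {j<..}" "h summable_on {..<j}" "h summable_on {j<..} \<union> {..<j}"
    by (rule summable_on_subset_banach[OF assms]; simp)+
  have "UNIV = {j} \<union> ({j<..} \<union> {..<j})" by auto
  then have "infsum h UNIV = infsum h ({j} \<union> ({j<..} \<union> {..<j}))" by simp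
  also have "\<dots> = infsum h {j} + (infsum h {j<..} + infsum h {..<j})"
    by (subst infsum_Un_disjoint[OF s(1,4)], force, subst infsum_Un_disjoint[OF s(2,3)]) auto
  also have "infsum h {j<..} = (\<Sum>\<^sub>\<infinity>m\<in>pos. h (j + int m))"
    by (rule infsum_reindex_bij_witness[where i = "\<lambda>m. j + int m" and j = "\<lambda>k. nat (k - j)"]) auto
  also have "infsum h {..<j} = (\<Sum>\<^sub>\<infinity>m\<in>pos. h (j - int m))"
    by (rule infsum_reindex_bij_witness[where i = "\<lambda>m. j - int m" and j = "\<lambda>k. nat (j - k)"]) auto
  finally show "(\<Sum>\<^sub>\<infinity>k. h k) = h j + (\<Sum>\<^sub>\<infinity>m\<in>pos. h (j + int m)) + (\<Sum>\<^sub>\<infinity>m\<in>pos. h (j - int m))" by simp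
  have "h summable_on (\<lambda>m. j + int m) ` A" "h summable_on (\<lambda>m. j - int m) ` A"
    by (rule summable_on_subset_banach[OF assms]; simp)+
  then show "(\<lambda>m. h (j + int m)) summable_on A" "(\<lambda>m. h (j - int m)) summable_on A"
    using summable_on_reindex[of "\<lambda>m. j + int m" A h] summable_on_reindex[of "\<lambda>m. j - int m" A h]
    by (auto simp: inj_on_def o_def)
qed

text \<open>Pairs j with -1 - j, the reflection under which the coefficients
  \<open>theta1_term\<close> change sign.\<close>

lemma has_sum_int_fold:
  fixes h :: "int \<Rightarrow> complex"
  assumes "(h has_sum S) UNIV"
  shows "((\<lambda>j. h (int j) + h (- 1 - int j)) has_sum S) UNIV"
proof -
  have s: "h summable_on {0..}" "h summable_on {..<0}"
    by (rule summable_on_subset_banach[OF has_sum_imp_summable[OF assms]]; simp)+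
  have "(h has_sum infsum h {0..} + infsum h {..<0}) ({0..} \<union> {..<0})"
    using s by (intro has_sum_Un_disjoint) (auto intro: has_sum_infsum)
  moreover have "{0..} \<union> {..<0} = (UNIV :: int set)" by auto
  ultimately have S: "S = infsum h {0..} + infsum h {..<0}"
    using assms by (metis has_sum_unique)
  have "(h has_sum infsum h {0..}) {0..} \<longleftrightarrow> ((\<lambda>j. h (int j)) has_sum infsum h {0..}) UNIV"
    by (rule has_sum_reindex_bij_witness[where i = int and j = nat]) auto
  moreover have "(h has_sum infsum h {..<0}) {..<0} \<longleftrightarrow> ((\<lambda>j. h (- 1 - int j)) has_sum infsum h {..<0}) UNIV"
    by (rule has_sum_reindex_bij_witness[where i = "\<lambda>j. - 1 - int j" and j = "\<lambda>k. nat (- 1 - k)"]) auto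
  ultimately show ?thesis unfolding S using s has_sum_add has_sum_infsum by blast
qed

text \<open>The reflection k -> -1 - k makes the whole sum vanish, so the parts to the right and to
  the left of j add up to minus the term at j.\<close>

lemma infsum_antisym:
  fixes h :: "int \<Rightarrow> complex"
  assumes "h summable_on UNIV" "\<And>k. h (- 1 - k) = - h k"
  shows "(\<Sum>\<^sub>\<infinity>m\<in>pos. h (j + int m)) + (\<Sum>\<^sub>\<infinity>m\<in>pos. h (j - int m)) = - h j"
proof -
  have "(\<Sum>\<^sub>\<infinity>k. h k) = (\<Sum>\<^sub>\<infinity>k. - h k)"
    by (rule infsum_reindex_bij_witness[where i = "\<lambda>k. - 1 - k" and j = "\<lambda>k. - 1 - k"]) (auto simp: assms)
  then have "(\<Sum>\<^sub>\<infinity>k. h k) = 0" by (simp add: infsum_uminus)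
  with infsum_int_split(1)[OF assms(1), of j] show ?thesis by (simp add: add_eq_0_iff algebra_simps)
qed

section \<open>Exponents and coefficients of the two theta series\<close>

definition tri :: "int \<Rightarrow> nat" where "tri k = nat (k * (k + 1) div 2)"

lemma int_tri: "2 * int (tri k) = k * (k + 1)"
proof -
  have "0 \<le> k * (k + 1)" by (cases "k \<ge> 0") (auto intro: mult_nonpos_nonpos)
  moreover have "even (k * (k + 1))" by simp
  ultimately show ?thesis unfolding tri_def by simp
qed

lemma abs_le_tri: "nat \<bar>k\<bar> \<le> 2 * tri k + 1"
proof -
  have "\<bar>k\<bar> \<le> k * (k + 1) + 1"
  proof (cases "k \<ge> 0")
    case False
    have "0 \<le> (k + 1) * (k + 1)" by simp
    with False show ?thesis by (simp add: algebra_simps)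
  qed (simp add: algebra_simps)
  then show ?thesis using int_tri[of k] by linarith
qed

definition sqn :: "int \<Rightarrow> nat" where "sqn k = nat (k ^ 2)"

lemma int_sqn: "int (sqn k) = k * k"
  unfolding sqn_def by (simp add: power2_eq_square)

lemma abs_le_square: "nat \<bar>k\<bar> \<le> 2 * sqn k + 1"
proof -
  have "\<bar>k\<bar> * 1 \<le> \<bar>k\<bar> * \<bar>k\<bar> \<or> k = 0" by (cases "k = 0") (auto intro!: mult_left_mono simp del: abs_mult_self_eq)
  then have "\<bar>k\<bar> \<le> int (sqn k)" unfolding int_sqn by auto
  then show ?thesis by linarith
qed

definition theta1_term :: "complex \<Rightarrow> int \<Rightarrow> complex" where "theta1_term q k = par k * q ^ tri k"
definition theta4_term :: "complex \<Rightarrow> int \<Rightarrow> complex" where "theta4_term q k = par k * q ^ sqn k"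

text \<open>The weight 2 k + 1 is centred at the symmetry point -1/2: it is odd under k -> -1 - k,
  as are the coefficients, so the moments of even order vanish.\<close>

definition theta1 :: "nat \<Rightarrow> complex \<Rightarrow> complex" where
  "theta1 r q = (\<Sum>\<^sub>\<infinity>k. of_int (2 * k + 1) ^ r * theta1_term q k)"
definition theta4 :: "nat \<Rightarrow> complex \<Rightarrow> complex" where
  "theta4 r q = (\<Sum>\<^sub>\<infinity>k. of_int k ^ r * theta4_term q k)"

lemma tri_minus: "tri (- 1 - k) = tri k"
  using int_tri[of k] int_tri[of "- 1 - k"] by (simp add: algebra_simps)

lemma theta1_term_minus: "theta1_term q (- 1 - k) = - theta1_term q k"
  unfolding theta1_term_def tri_minus by (simp add: par_def)

lemma theta4_term_minus: "theta4_term q (- k) = theta4_term q k"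
  unfolding theta4_term_def sqn_def by simp

lemma signed_power_eq:
  fixes q :: complex
  assumes "a + e = b + e'"
  shows "q ^ a * (p * q ^ e) = q ^ b * (p * q ^ e')"
  using assms by (metis mult.left_commute power_add)

lemma signed_power_minus:
  fixes q :: complex
  assumes "a + e = b + e'" "p' = - p"
  shows "q ^ a * (p' * q ^ e) = - (q ^ b * (p * q ^ e'))"
  using signed_power_eq[OF assms(1), of q p] assms(2) by simp

lemma par_shift: "par (k + 1 + l) = - par (k + l)" "par (k + 1 - l) = - par (k - l)" "par (k + 1) = - par k"
  unfolding par_def by auto

lemma theta1_term_shift:
  fixes j m :: nat
  shows "q ^ m * theta1_term q (int j + 1 - int m) = - (q ^ (j + 1) * theta1_term q (int j - int m))"
    and "theta1_term q (int j + 1 + int m) = - (q ^ (j + 1 + m) * theta1_term q (int j + int m))"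
proof -
  have "m + tri (int j + 1 - int m) = (j + 1) + tri (int j - int m)"
    using int_tri[of "int j + 1 - int m"] int_tri[of "int j - int m"] by (simp add: algebra_simps)
  from signed_power_minus[OF this par_shift(2), of q]
  show "q ^ m * theta1_term q (int j + 1 - int m) = - (q ^ (j + 1) * theta1_term q (int j - int m))"
    unfolding theta1_term_def .
  have "0 + tri (int j + 1 + int m) = (j + 1 + m) + tri (int j + int m)"
    using int_tri[of "int j + 1 + int m"] int_tri[of "int j + int m"] by (simp add: algebra_simps)
  from signed_power_minus[OF this par_shift(1), of q]
  show "theta1_term q (int j + 1 + int m) = - (q ^ (j + 1 + m) * theta1_term q (int j + int m))"
    unfolding theta1_term_def by (simp only: power_0 mult_1)
qed

text \<open>The last three relations trade squares for triangular exponents at q^2, as in m + (j + 1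
  - m)^2 = (j + 1) + (j - m) (j - m + 1). The antisymmetry of \<open>theta1_term (q ^ 2)\<close>
  then becomes usable for \<open>theta4_term\<close>.\<close>

lemma theta4_term_shift:
  fixes j m :: nat
  shows "q ^ (2 * m) * theta4_term q (int j + 1 - int m) = - (q ^ (2 * j + 1) * theta4_term q (int j - int m))"
    and "theta4_term q (int j + 1 + int m) = - (q ^ (2 * j + 1 + 2 * m) * theta4_term q (int j + int m))"
    and "q ^ m * theta4_term q (int j + 1 - int m) = - (q ^ (j + 1) * theta1_term (q ^ 2) (int j - int m))"
    and "q ^ (2 * j + 1 + m) * theta4_term q (int j + int m) = q ^ (j + 1) * theta1_term (q ^ 2) (int j + int m)"
    and "q ^ (j + 1) * theta1_term (q ^ 2) (int j) = - theta4_term q (int j + 1)"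
proof -
  have "2 * m + sqn (int j + 1 - int m) = (2 * j + 1) + sqn (int j - int m)"
    using int_sqn[of "int j + 1 - int m"] int_sqn[of "int j - int m"] by (simp add: algebra_simps)
  from signed_power_minus[OF this par_shift(2), of q]
  show "q ^ (2 * m) * theta4_term q (int j + 1 - int m) = - (q ^ (2 * j + 1) * theta4_term q (int j - int m))"
    unfolding theta4_term_def .
  have "0 + sqn (int j + 1 + int m) = (2 * j + 1 + 2 * m) + sqn (int j + int m)"
    using int_sqn[of "int j + 1 + int m"] int_sqn[of "int j + int m"] by (simp add: algebra_simps)
  from signed_power_minus[OF this par_shift(1), of q]
  show "theta4_term q (int j + 1 + int m) = - (q ^ (2 * j + 1 + 2 * m) * theta4_term q (int j + int m))"
    unfolding theta4_term_def by (simp only: power_0 mult_1)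
  have "m + sqn (int j + 1 - int m) = (j + 1) + 2 * tri (int j - int m)"
    using int_sqn[of "int j + 1 - int m"] int_tri[of "int j - int m"] by (simp add: algebra_simps)
  from signed_power_minus[OF this par_shift(2), of q]
  show "q ^ m * theta4_term q (int j + 1 - int m) = - (q ^ (j + 1) * theta1_term (q ^ 2) (int j - int m))"
    unfolding theta4_term_def theta1_term_def power_mult[symmetric] .
  have "2 * j + 1 + m + sqn (int j + int m) = (j + 1) + 2 * tri (int j + int m)"
    using int_sqn[of "int j + int m"] int_tri[of "int j + int m"] by (simp add: algebra_simps)
  from signed_power_eq[OF this, of q "par (int j + int m)"]
  show "q ^ (2 * j + 1 + m) * theta4_term q (int j + int m) = q ^ (j + 1) * theta1_term (q ^ 2) (int j + int m)"
    unfolding theta4_term_def theta1_term_def power_mult[symmetric] .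
  have "(j + 1) + 2 * tri (int j) = 0 + sqn (int j + 1)"
    using int_sqn[of "int j + 1"] int_tri[of "int j"] by (simp add: algebra_simps)
  from signed_power_minus[OF this[symmetric] par_shift(3)[of "int j"], of q]
  show "q ^ (j + 1) * theta1_term (q ^ 2) (int j) = - theta4_term q (int j + 1)"
    unfolding theta4_term_def theta1_term_def power_mult[symmetric] by (simp only: power_0 mult_1 minus_minus)
qed

lemma summable_on_bounded_mult:
  fixes f g :: "'a \<Rightarrow> complex"
  assumes "f summable_on A" "\<And>x. x \<in> A \<Longrightarrow> norm (g x) \<le> K"
  shows "(\<lambda>x. g x * f x) summable_on A"
proof (rule summable_on_bound)
  show "(\<lambda>x. K * norm (f x)) summable_on A"
    using assms(1) by (intro summable_on_cmult_right) (simp add: summable_on_iff_abs_summable_on_complex)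
  show "norm (g x * f x) \<le> K * norm (f x)" if "x \<in> A" for x
    unfolding norm_mult using assms(2)[OF that] by (intro mult_right_mono) auto
qed

lemma
  assumes q: "norm q < 1"
  shows theta1_term_summable: "(\<lambda>k. of_int (a * k + b) ^ r * theta1_term q k) summable_on UNIV"
    and theta4_term_summable: "(\<lambda>k. of_int (a * k + b) ^ r * theta4_term q k) summable_on UNIV"
proof -
  have c: "norm (of_int (a * k + b) ^ r * par k) \<le> (real_of_int \<bar>a\<bar> + real_of_int \<bar>b\<bar>) ^ r * (1 + real (nat \<bar>k\<bar>)) ^ r" for k
  proof -
    have "\<bar>a * k + b\<bar> \<le> (\<bar>a\<bar> + \<bar>b\<bar>) * (1 + \<bar>k\<bar>)"
      by (rule order_trans[OF abs_triangle_ineq]) (simp add: abs_mult algebra_simps)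
    then have "real_of_int \<bar>a * k + b\<bar> \<le> real_of_int ((\<bar>a\<bar> + \<bar>b\<bar>) * (1 + \<bar>k\<bar>))" by (simp only: of_int_le_iff)
    then have "real_of_int \<bar>a * k + b\<bar> ^ r \<le> ((real_of_int \<bar>a\<bar> + real_of_int \<bar>b\<bar>) * (1 + real (nat \<bar>k\<bar>))) ^ r"
      by (intro power_mono) auto
    then show ?thesis
      unfolding norm_mult norm_power norm_of_int by (simp add: power_mult_distrib)
  qed
  show "(\<lambda>k. of_int (a * k + b) ^ r * theta1_term q k) summable_on UNIV"
    using tame_power_series_summable[OF tame_int q abs_le_tri c, of UNIV] by (simp add: theta1_term_def mult.assoc)
  show "(\<lambda>k. of_int (a * k + b) ^ r * theta4_term q k) summable_on UNIV"
    using tame_power_series_summable[OF tame_int q abs_le_square c, of UNIV] by (simp add: theta4_term_def mult.assoc)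
qed

text \<open>For theta(z) = sum t(k) z^k the triple product predicts z theta' = theta (sum z^(-m) -
  sum u_m (z^m - z^(-m))), sums over m >= 1; this is the coefficient of z^j. The proof replaces the
  product by induction on j: once the denominator 1 - q^m is cleared, the step is a relation between
  the four coefficients at j and j + 1, shifted by m and -m.\<close>

lemma geo_theta1:
  assumes q: "norm q < 1"
  shows "((\<lambda>m. geo q m * (theta1_term q (int j - int m) - theta1_term q (int j + int m))) has_sum
    - of_nat j * theta1_term q (int j) + (\<Sum>\<^sub>\<infinity>m\<in>pos. theta1_term q (int j + int m))) pos"
proof (induction j)
  note summ = infsum_int_split(2,3)[OF theta1_term_summable[OF q, of 0 1 0, simplified], of _ pos]
  {
    case 0
    have "geo q m * (theta1_term q (int 0 - int m) - theta1_term q (int 0 + int m)) = theta1_term q (int 0 + int m)" if "m \<in> pos" for m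
    proof -
      obtain n where m: "m = Suc n" using \<open>m \<in> pos\<close> not0_implies_Suc[of m] by auto
      have 1: "theta1_term q (- int m) = - theta1_term q (int n)" using theta1_term_minus[of q "int n"] by (simp add: m)
      have 2: "theta1_term q (int m) = - (q ^ m * theta1_term q (int n))" using theta1_term_shift(2)[of q 0 n] by (simp add: m add.commute)
      have "1 - q ^ m \<noteq> 0" using power_neq_1[OF q, of m] that by auto
      then show ?thesis unfolding geo_def by (simp add: 1 2 field_simps)
    qed
    then have "((\<lambda>m. geo q m * (theta1_term q (int 0 - int m) - theta1_term q (int 0 + int m))) has_sum (\<Sum>\<^sub>\<infinity>m\<in>pos. theta1_term q (int 0 + int m))) pos"
      using has_sum_infsum[OF summ(1), of "int 0"] by (subst has_sum_cong) auto
    then show ?case by simp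
  next
    case (Suc j)
    let ?Q = "q ^ (j + 1)"
    \<comment> \<open>The two tails around j give -t(j); together with t(j + 1) = - q^(j+1) t(j)
      this raises the factor j to j + 1.\<close>
    have s: "(\<Sum>\<^sub>\<infinity>m\<in>pos. theta1_term q (int j + int m)) + (\<Sum>\<^sub>\<infinity>m\<in>pos. theta1_term q (int j - int m)) = - theta1_term q (int j)"
      by (rule infsum_antisym) (use theta1_term_summable[OF q, of 0 1 0] theta1_term_minus in auto)
    have "((\<lambda>m. theta1_term q (int j + 1 + int m) - ?Q * theta1_term q (int j - int m)
          - ?Q * (geo q m * (theta1_term q (int j - int m) - theta1_term q (int j + int m)))) has_sum
        (\<Sum>\<^sub>\<infinity>m\<in>pos. theta1_term q (int j + 1 + int m)) - ?Q * (\<Sum>\<^sub>\<infinity>m\<in>pos. theta1_term q (int j - int m))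
          - ?Q * (- of_nat j * theta1_term q (int j) + (\<Sum>\<^sub>\<infinity>m\<in>pos. theta1_term q (int j + int m)))) pos"
      by (intro has_sum_diff has_sum_cmult_right has_sum_infsum summ Suc)
    also have "(\<Sum>\<^sub>\<infinity>m\<in>pos. theta1_term q (int j + 1 + int m)) - ?Q * (\<Sum>\<^sub>\<infinity>m\<in>pos. theta1_term q (int j - int m))
          - ?Q * (- of_nat j * theta1_term q (int j) + (\<Sum>\<^sub>\<infinity>m\<in>pos. theta1_term q (int j + int m)))
        = (\<Sum>\<^sub>\<infinity>m\<in>pos. theta1_term q (int j + 1 + int m)) + ?Q * (of_nat j * theta1_term q (int j)) - ?Q *
           ((\<Sum>\<^sub>\<infinity>m\<in>pos. theta1_term q (int j + int m)) + (\<Sum>\<^sub>\<infinity>m\<in>pos. theta1_term q (int j - int m)))"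
      by (simp add: algebra_simps)
    also have "\<dots> = - of_nat (Suc j) * theta1_term q (int j + 1) + (\<Sum>\<^sub>\<infinity>m\<in>pos. theta1_term q (int j + 1 + int m))"
      unfolding s using theta1_term_shift(2)[of q j 0] by (simp add: algebra_simps)
    finally have "((\<lambda>m. theta1_term q (int j + 1 + int m) - ?Q * theta1_term q (int j - int m)
          - ?Q * (geo q m * (theta1_term q (int j - int m) - theta1_term q (int j + int m)))) has_sum
        - of_nat (Suc j) * theta1_term q (int j + 1) + (\<Sum>\<^sub>\<infinity>m\<in>pos. theta1_term q (int j + 1 + int m))) pos" .
    moreover have "theta1_term q (int j + 1 + int m) - ?Q * theta1_term q (int j - int m)
          - ?Q * (geo q m * (theta1_term q (int j - int m) - theta1_term q (int j + int m)))
        = geo q m * (theta1_term q (int j + 1 - int m) - theta1_term q (int j + 1 + int m))" if "m \<in> pos" for m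
    proof -
      define y Q T U V W where "y = q ^ m" and "Q = q ^ (j + 1)" and "T = theta1_term q (int j + 1 - int m)"
        and "U = theta1_term q (int j - int m)" and "V = theta1_term q (int j + int m)" and "W = theta1_term q (int j + 1 + int m)"
      have "1 - y \<noteq> 0" using power_neq_1[OF q, of m] that by (auto simp: y_def)
      moreover have "y * T = - (Q * U)" "W = - (Q * y * V)"
        using theta1_term_shift[where q = q and m = m and j = j] by (simp_all add: y_def T_def Q_def U_def V_def W_def power_add)
      ultimately have "W - Q * U - Q * (y / (1 - y) * (U - V)) = y / (1 - y) * (T - W)"
        by (simp add: divide_simps) algebra
      then show ?thesis by (simp only: y_def T_def Q_def U_def V_def W_def geo_def)
    qed
    ultimately have "((\<lambda>m. geo q m * (theta1_term q (int j + 1 - int m) - theta1_term q (int j + 1 + int m))) has_sum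
        - of_nat (Suc j) * theta1_term q (int j + 1) + (\<Sum>\<^sub>\<infinity>m\<in>pos. theta1_term q (int j + 1 + int m))) pos"
      by (subst (asm) has_sum_cong)
    then show ?case by (simp add: add_ac)
  }
qed

text \<open>The corresponding coefficient identity for the series with exponents l^2. Its product
  has factors 1 - z q^(2n-1) and 1 - q^(2n-1) / z, whence the weights q^m / (1 - q^(2m)); since z =
  1 is not a zero, no tail appears. In the induction step the correction terms are
  \<open>theta1_term (q ^ 2)\<close> at j + m and j - m, summed by antisymmetry.\<close>

lemma geo_theta4:
  assumes q: "norm q < 1"
  shows "((\<lambda>m. q ^ m / (1 - q ^ (2 * m)) * (theta4_term q (int j - int m) - theta4_term q (int j + int m))) has_sum
    - of_nat j * theta4_term q (int j)) pos"
proof (induction j)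
  case 0
  then show ?case using theta4_term_minus[of q] by simp
next
  case (Suc j)
  have q2: "norm (q ^ 2) < 1" using q by (simp add: norm_power power_less_one_iff)
  note summ = infsum_int_split(2,3)[OF theta1_term_summable[OF q2, of 0 1 0, simplified], of _ pos]
  let ?Q = "q ^ (2 * j + 1)" and ?t = "theta1_term (q ^ 2)"
  have s: "(\<Sum>\<^sub>\<infinity>m\<in>pos. ?t (int j + int m)) + (\<Sum>\<^sub>\<infinity>m\<in>pos. ?t (int j - int m)) = - ?t (int j)"
    by (rule infsum_antisym) (use theta1_term_summable[OF q2, of 0 1 0] theta1_term_minus in auto)
  have "((\<lambda>m. - (q ^ (j + 1)) * (?t (int j + int m) + ?t (int j - int m))
        - ?Q * (q ^ m / (1 - q ^ (2 * m)) * (theta4_term q (int j - int m) - theta4_term q (int j + int m)))) has_sum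
      - (q ^ (j + 1)) * ((\<Sum>\<^sub>\<infinity>m\<in>pos. ?t (int j + int m)) + (\<Sum>\<^sub>\<infinity>m\<in>pos. ?t (int j - int m)))
        - ?Q * (- of_nat j * theta4_term q (int j))) pos"
    by (intro has_sum_diff has_sum_add has_sum_cmult_right has_sum_infsum summ Suc)
  also have "- (q ^ (j + 1)) * ((\<Sum>\<^sub>\<infinity>m\<in>pos. ?t (int j + int m)) + (\<Sum>\<^sub>\<infinity>m\<in>pos. ?t (int j - int m)))
        - ?Q * (- of_nat j * theta4_term q (int j)) = - of_nat (Suc j) * theta4_term q (int j + 1)"
    unfolding s using theta4_term_shift(5)[of q j] theta4_term_shift(2)[of q j 0] by (simp add: algebra_simps)
  finally have "((\<lambda>m. - (q ^ (j + 1)) * (?t (int j + int m) + ?t (int j - int m))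
        - ?Q * (q ^ m / (1 - q ^ (2 * m)) * (theta4_term q (int j - int m) - theta4_term q (int j + int m)))) has_sum
        - of_nat (Suc j) * theta4_term q (int j + 1)) pos" .
  moreover have "- (q ^ (j + 1)) * (?t (int j + int m) + ?t (int j - int m))
        - ?Q * (q ^ m / (1 - q ^ (2 * m)) * (theta4_term q (int j - int m) - theta4_term q (int j + int m)))
      = q ^ m / (1 - q ^ (2 * m)) * (theta4_term q (int j + 1 - int m) - theta4_term q (int j + 1 + int m))" if "m \<in> pos" for m
  proof -
    define y z Q T U V W A B where "y = q ^ m" and "z = q ^ (2 * m)" and "Q = ?Q" and "T = theta4_term q (int j + 1 - int m)"
      and "U = theta4_term q (int j - int m)" and "V = theta4_term q (int j + int m)" and "W = theta4_term q (int j + 1 + int m)"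
      and "A = q ^ (j + 1) * ?t (int j + int m)" and "B = q ^ (j + 1) * ?t (int j - int m)"
    have "1 - z \<noteq> 0" using power_neq_1[OF q, of "2 * m"] that by (auto simp: z_def)
    moreover have "z * T = - (Q * U)" "W = - (Q * z * V)" "y * T = - B" "Q * y * V = A"
      using theta4_term_shift(1-4)[where q = q and m = m and j = j]
      by (simp_all add: y_def z_def T_def Q_def U_def V_def W_def A_def B_def power_add)
    ultimately have "- (A + B) - Q * (y / (1 - z) * (U - V)) = y / (1 - z) * (T - W)"
      by (simp add: divide_simps) algebra
    then show ?thesis by (simp add: y_def z_def T_def Q_def U_def V_def W_def A_def B_def algebra_simps)
  qed
  ultimately have "((\<lambda>m. q ^ m / (1 - q ^ (2 * m)) * (theta4_term q (int j + 1 - int m) - theta4_term q (int j + 1 + int m))) has_sum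
      - of_nat (Suc j) * theta4_term q (int j + 1)) pos"
    by (subst (asm) has_sum_cong)
  then show ?case by (simp add: add_ac)
qed

section \<open>Moments of the theta series\<close>

lemma has_sum_times:
  fixes f :: "'a \<Rightarrow> complex" and g :: "'b \<Rightarrow> complex"
  assumes "(f has_sum a) A" "(g has_sum b) B"
  shows "((\<lambda>(x, y). f x * g y) has_sum a * b) (A \<times> B)"
  using has_sum_infsum[OF summable_on_times[OF assms[THEN has_sum_imp_summable]]]
    infsum_times[OF assms[THEN has_sum_imp_summable]] infsumI[OF assms(1)] infsumI[OF assms(2)] by simp

context
  fixes q :: complex
  assumes q: "norm q < 1"
begin

lemma theta1_has_sum: "((\<lambda>k. of_int (2 * k + 1) ^ r * theta1_term q k) has_sum theta1 r q) UNIV"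
  unfolding theta1_def by (intro has_sum_infsum theta1_term_summable[OF q])

lemma theta4_has_sum: "((\<lambda>k. of_int k ^ r * theta4_term q k) has_sum theta4 r q) UNIV"
  using has_sum_infsum[OF theta4_term_summable[OF q, of 1 0 r]] by (simp add: theta4_def)

lemma theta1_even: "even r \<Longrightarrow> theta1 r q = 0"
proof -
  assume r: "even r"
  have "theta1 r q = (\<Sum>\<^sub>\<infinity>k. - (of_int (2 * k + 1) ^ r * theta1_term q k))"
    unfolding theta1_def
  proof (rule infsum_reindex_bij_witness[where i = "\<lambda>k. - 1 - k" and j = "\<lambda>k. - 1 - k"])
    fix k :: int
    have "of_int (2 * (- 1 - k) + 1) = - (of_int (2 * k + 1) :: complex)" by simp
    then show "- (of_int (2 * (- 1 - k) + 1) ^ r * theta1_term q (- 1 - k)) = of_int (2 * k + 1) ^ r * theta1_term q k"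
      using r by (simp only: theta1_term_minus power_minus_even) simp
  qed auto
  then show ?thesis by (simp add: infsum_uminus theta1_def)
qed

lemma theta4_odd: "odd r \<Longrightarrow> theta4 r q = 0"
proof -
  assume r: "odd r"
  have "theta4 r q = (\<Sum>\<^sub>\<infinity>k. - (of_int k ^ r * theta4_term q k))"
    unfolding theta4_def
    by (rule infsum_reindex_bij_witness[where i = uminus and j = uminus]) (use r theta4_term_minus in auto)
  then show ?thesis by (simp add: infsum_uminus theta4_def)
qed

lemma sum_odd_squares: "(\<Sum>j<n. (2 * of_nat j + 1) ^ 2) = of_nat n * (4 * of_nat n ^ 2 - 1) / (3 :: complex)"
  by (induction n) (simp_all add: field_simps power2_eq_square)

text \<open>The identity \<open>geo_theta1\<close> is weighted by (2 j + 1)^2 and summed over j. In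
  (2 (k + m) + 1)^2 only the mixed term 4 m (2 k + 1) survives, because moments of even order
  vanish; the other side is a combination of the third and the first moment.\<close>

lemma theta1_ratio: "theta1 3 q = (1 - 24 * lambert 1 1 q) * theta1 1 q"
proof -
  let ?t = "theta1_term q" and ?S = "4 * lambert 1 1 q * theta1 1 q"
  note L = lambert_geo_pm(1)[OF q] and summ = infsum_int_split(2,3)[OF theta1_term_summable[OF q, of 0 1 0, simplified]]
  have "((\<lambda>(m, k). of_nat m ^ 0 * geo q m * (of_int (2 * k + 1) ^ 2 * ?t k)) has_sum lambert 1 0 q * theta1 2 q) (pos \<times> UNIV)"
    "((\<lambda>(m, k). of_nat m ^ 1 * geo q m * (of_int (2 * k + 1) ^ 1 * ?t k)) has_sum lambert 1 1 q * theta1 1 q) (pos \<times> UNIV)"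
    "((\<lambda>(m, k). of_nat m ^ 2 * geo q m * (of_int (2 * k + 1) ^ 0 * ?t k)) has_sum lambert 1 2 q * theta1 0 q) (pos \<times> UNIV)"
    by (rule has_sum_times[OF L theta1_has_sum])+
  from has_sum_add[OF has_sum_add[OF this(1) has_sum_cmult_right[OF this(2), of 4]] has_sum_cmult_right[OF this(3), of 4]]
  have "((\<lambda>(m, k). of_int (2 * (k + int m) + 1) ^ 2 * (geo q m * ?t k)) has_sum ?S) (pos \<times> UNIV)"
    by (simp add: theta1_even case_prod_unfold algebra_simps power2_eq_square)
  also have "?this \<longleftrightarrow> ((\<lambda>(j, m). of_int (2 * j + 1) ^ 2 * (geo q m * ?t (j - int m))) has_sum ?S) (UNIV \<times> pos)"
    by (rule has_sum_reindex_bij_witness[where i = "\<lambda>(j, m). (m, j - int m)" and j = "\<lambda>(m, k). (k + int m, m)"]) auto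
  finally have *: "((\<lambda>(j, m). of_int (2 * j + 1) ^ 2 * (geo q m * ?t (j - int m))) has_sum ?S) (UNIV \<times> pos)" .
  define g where "g j = (\<Sum>\<^sub>\<infinity>m\<in>pos. geo q m * ?t (j - int m))" for j
  have g: "((\<lambda>m. geo q m * ?t (j - int m)) has_sum g j) pos" for j
    unfolding g_def using norm_geo_le_const[OF q] by (intro has_sum_infsum summable_on_bounded_mult[OF summ(2)]) auto
  have "((\<lambda>j. of_int (2 * j + 1) ^ 2 * g j) has_sum ?S) UNIV"
    by (rule has_sum_SigmaD[OF *]) (use g in \<open>auto intro!: has_sum_cmult_right\<close>)
  \<comment> \<open>The indices j and -1 - j have the same weight, and g(j) + g(-1 - j) is the
    left-hand side of \<open>geo_theta1\<close>.\<close>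
  from has_sum_int_fold[OF this]
  have S: "((\<lambda>j. of_int (2 * int j + 1) ^ 2 * (g (int j) + g (- 1 - int j))) has_sum ?S) UNIV"
    by (rule iffD1[OF has_sum_cong, rotated]) (simp add: algebra_simps power2_eq_square)
  have gg: "g (int j) + g (- 1 - int j) = - of_nat j * ?t (int j) + (\<Sum>\<^sub>\<infinity>m\<in>pos. ?t (int j + int m))" for j
  proof (rule has_sum_unique[OF _ geo_theta1[OF q]])
    have "?t (- 1 - int j - int m) = - ?t (int j + int m)" for m
      using theta1_term_minus[of q "int j + int m"] by (simp add: algebra_simps)
    then show "((\<lambda>m. geo q m * (?t (int j - int m) - ?t (int j + int m))) has_sum g (int j) + g (- 1 - int j)) pos"
      using has_sum_add[OF g[of "int j"] g[of "- 1 - int j"]] by (simp add: algebra_simps)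
  qed
  \<comment> \<open>The tails of \<open>geo_theta1\<close>; after exchanging the summations, t(n)
    collects the weights of all j < n.\<close>
  define X where "X = (\<Sum>\<^sub>\<infinity>(j, m)\<in>UNIV \<times> pos. (2 * of_nat j + 1) ^ 2 * ?t (int (j + m)))"
  have X: "((\<lambda>(j, m). (2 * of_nat j + 1) ^ 2 * ?t (int (j + m))) has_sum X) (UNIV \<times> pos)"
    unfolding X_def
  proof (rule has_sum_infsum)
    have "(\<lambda>p. ((2 * of_nat (fst p) + 1) ^ 2 * par (int (fst p + snd p))) * q ^ tri (int (fst p + snd p)))
        summable_on UNIV \<times> pos"
    proof (rule tame_power_series_summable[OF tame_pairs q, where C = 4 and d = 2])
      fix p :: "nat \<times> nat"
      show "(case p of (a, b) \<Rightarrow> a + b) \<le> 2 * tri (int (fst p + snd p)) + 1"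
        using abs_le_tri[of "int (fst p + snd p)"] by (simp add: case_prod_unfold)
      have "norm (2 * of_nat (fst p) + 1 :: complex) \<le> 2 * (1 + real (fst p + snd p))"
        by (rule order_trans[OF norm_triangle_ineq]) (simp add: norm_mult)
      from power_mono[OF this, of 2]
      show "norm ((2 * of_nat (fst p) + 1) ^ 2 * par (int (fst p + snd p)))
          \<le> 4 * (1 + real (case p of (a, b) \<Rightarrow> a + b)) ^ 2"
        unfolding norm_mult norm_power par_simps(7) case_prod_unfold power_mult_distrib mult_1_right by simp
    qed
    then show "(\<lambda>(j, m). (2 * of_nat j + 1) ^ 2 * ?t (int (j + m))) summable_on UNIV \<times> pos"
      by (simp add: theta1_term_def case_prod_unfold mult.assoc)
  qed
  have X1: "((\<lambda>j. (2 * of_nat j + 1) ^ 2 * (\<Sum>\<^sub>\<infinity>m\<in>pos. ?t (int j + int m))) has_sum X) UNIV"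
    by (rule has_sum_SigmaD[OF X]) (use summ(1) in \<open>auto intro!: has_sum_cmult_right has_sum_infsum\<close>)
  have "((\<lambda>(n, j). (2 * of_nat j + 1) ^ 2 * ?t (int n)) has_sum X) (SIGMA n:UNIV. {..<n}) \<longleftrightarrow>
      ((\<lambda>(j, m). (2 * of_nat j + 1) ^ 2 * ?t (int (j + m))) has_sum X) (UNIV \<times> pos)"
    by (rule has_sum_reindex_bij_witness[where i = "\<lambda>(j, m). (j + m, j)" and j = "\<lambda>(n, j). (j, n - j)"]) auto
  with X have "((\<lambda>(n, j). (2 * of_nat j + 1) ^ 2 * ?t (int n)) has_sum X) (SIGMA n:UNIV. {..<n})" by blast
  then have X2: "((\<lambda>n. (\<Sum>j<n. (2 * of_nat j + 1) ^ 2) * ?t (int n)) has_sum X) UNIV"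
    by (rule has_sum_SigmaD) (auto intro!: has_sum_finiteI simp: sum_distrib_right)
  \<comment> \<open>The coefficient of t(n) is -n (2n+1)^2 + n (4n^2-1) / 3 = -((2n+1)^3 - (2n+1)) /
    3. The factors 2 prepare the return from n >= 0 to moments over all integers.\<close>
  have 1: "((\<lambda>n. - (1 / 6) * (2 * (of_int (2 * int n + 1) ^ 3 * ?t (int n)) - 2 * (of_int (2 * int n + 1) ^ 1 * ?t (int n)))) has_sum ?S) UNIV"
  proof (rule iffD1[OF has_sum_cong])
    show "((\<lambda>n. of_int (2 * int n + 1) ^ 2 * (g (int n) + g (- 1 - int n))
        - (2 * of_nat n + 1) ^ 2 * (\<Sum>\<^sub>\<infinity>m\<in>pos. ?t (int n + int m))
        + (\<Sum>j<n. (2 * of_nat j + 1) ^ 2) * ?t (int n)) has_sum ?S) UNIV"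
      using has_sum_add[OF has_sum_diff[OF S X1] X2] by simp
  qed (unfold gg sum_odd_squares, simp add: field_simps eval_nat_numeral)
  have fold: "((\<lambda>n. 2 * (of_int (2 * int n + 1) ^ r * ?t (int n))) has_sum theta1 r q) UNIV" if "odd r" for r
  proof (rule iffD1[OF has_sum_cong has_sum_int_fold[OF theta1_has_sum]])
    fix n :: nat
    have "of_int (2 * (- 1 - int n) + 1) = - (of_int (2 * int n + 1) :: complex)" by simp
    then have "of_int (2 * (- 1 - int n) + 1) ^ r = - (of_int (2 * int n + 1) ^ r :: complex)"
      using power_minus_odd[OF that] by (simp only:)
    then show "of_int (2 * int n + 1) ^ r * ?t (int n) + of_int (2 * (- 1 - int n) + 1) ^ r * ?t (- 1 - int n)
        = 2 * (of_int (2 * int n + 1) ^ r * ?t (int n))"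
      unfolding theta1_term_minus by (simp only: minus_mult_minus mult_2)
  qed
  have "?S = - (1 / 6) * (theta1 3 q - theta1 1 q)"
    by (rule has_sum_unique[OF 1]) (intro has_sum_cmult_right has_sum_diff fold; simp)
  then show ?thesis by (simp add: field_simps)
qed

text \<open>The even indices n = 2 m are selected by (1 + (-1)^n) / 2, and m^s = n^s / 2^s.\<close>

lemma lambert_double:
  "((\<lambda>m. of_nat m ^ s * geo q (2 * m)) has_sum (lambert 1 s q + lambert (- 1) s q) / 2 ^ Suc s) pos"
proof -
  let ?f = "\<lambda>n. of_nat n ^ s * geo q n / 2 ^ s"
  have "((\<lambda>n. 1 / 2 ^ Suc s * (of_nat n ^ s * geo q n + (- 1) ^ n * of_nat n ^ s * geo q n)) has_sum
      1 / 2 ^ Suc s * (lambert 1 s q + lambert (- 1) s q)) pos"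
    by (intro has_sum_cmult_right has_sum_add lambert_geo_pm[OF q])
  also have "?this \<longleftrightarrow> (?f has_sum 1 / 2 ^ Suc s * (lambert 1 s q + lambert (- 1) s q)) {n\<in>pos. even n}"
    by (rule has_sum_cong_neutral) (auto simp: field_simps)
  also have "\<dots> \<longleftrightarrow> ((\<lambda>m. of_nat m ^ s * geo q (2 * m)) has_sum
      1 / 2 ^ Suc s * (lambert 1 s q + lambert (- 1) s q)) pos"
    by (rule has_sum_reindex_bij_witness[where i = "\<lambda>m. 2 * m" and j = "\<lambda>n. n div 2"])
      (auto elim!: evenE simp: power_mult_distrib)
  finally show ?thesis by simp
qed

text \<open>Since q^m / (1 - q^(2m)) = u_m - u_(2m), the weights of \<open>geo_theta4\<close> sum to
  Lambert series. The weight j suffices: in k + m the part k gives a vanishing odd moment, and on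
  the other side j times -j yields the second moment.\<close>

lemma theta4_ratio: "theta4 2 q = - (3 * lambert 1 1 q - lambert (- 1) 1 q) / 2 * theta4 0 q"
proof -
  let ?s = "theta4_term q" and ?v = "\<lambda>m. q ^ m / (1 - q ^ (2 * m))"
  note summ = infsum_int_split(2,3)[OF theta4_term_summable[OF q, of 0 1 0, simplified]]
  have v: "?v m = geo q m - geo q (2 * m)" if "m \<in> pos" for m
  proof -
    have "1 - q ^ m \<noteq> 0" "1 - q ^ (2 * m) \<noteq> 0" using power_neq_1[OF q, of m] power_neq_1[OF q, of "2 * m"] that by auto
    then show ?thesis unfolding geo_def mult_2 power_add by (simp add: divide_simps) (simp add: algebra_simps)
  qed
  define V where "V s = lambert 1 s q - (lambert 1 s q + lambert (- 1) s q) / 2 ^ Suc s" for s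
  have V: "((\<lambda>m. of_nat m ^ s * ?v m) has_sum V s) pos" for s
    unfolding V_def
    by (rule iffD1[OF has_sum_cong has_sum_diff[OF lambert_geo_pm(1)[OF q] lambert_double]]) (simp only: v right_diff_distrib)
  let ?S = "V 1 * theta4 0 q"
  have "((\<lambda>(m, k). of_nat m ^ 0 * ?v m * (of_int k ^ 1 * ?s k)) has_sum V 0 * theta4 1 q) (pos \<times> UNIV)"
    "((\<lambda>(m, k). of_nat m ^ 1 * ?v m * (of_int k ^ 0 * ?s k)) has_sum V 1 * theta4 0 q) (pos \<times> UNIV)"
    by (rule has_sum_times[OF V theta4_has_sum])+
  from has_sum_add[OF this]
  have "((\<lambda>(m, k). of_int (k + int m) * (?v m * ?s k)) has_sum ?S) (pos \<times> UNIV)"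
    by (simp add: theta4_odd case_prod_unfold algebra_simps add_divide_distrib)
  also have "?this \<longleftrightarrow> ((\<lambda>(j, m). of_int j * (?v m * ?s (j - int m))) has_sum ?S) (UNIV \<times> pos)"
    by (rule has_sum_reindex_bij_witness[where i = "\<lambda>(j, m). (m, j - int m)" and j = "\<lambda>(m, k). (k + int m, m)"]) auto
  finally have *: "((\<lambda>(j, m). of_int j * (?v m * ?s (j - int m))) has_sum ?S) (UNIV \<times> pos)" .
  define g where "g j = (\<Sum>\<^sub>\<infinity>m\<in>pos. ?v m * ?s (j - int m))" for j
  have vb: "norm (?v m) \<le> 2 / (1 - norm q)" if "m \<in> pos" for m
    using norm_geo_le_const[OF q, of m] norm_geo_le_const[OF q, of "2 * m"] that unfolding v[OF that]
    by (intro order_trans[OF norm_triangle_ineq4]) auto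
  have g: "((\<lambda>m. ?v m * ?s (j - int m)) has_sum g j) pos" for j
    unfolding g_def using vb by (intro has_sum_infsum summable_on_bounded_mult[OF summ(2)])
  have S: "((\<lambda>j. of_int j * g j) has_sum ?S) UNIV"
    by (rule has_sum_SigmaD[OF *], simp only: prod.case, rule has_sum_cmult_right[OF g])
  have gg: "g (int j) - g (- int j) = - of_nat j * ?s (int j)" for j
  proof (rule has_sum_unique[OF _ geo_theta4[OF q]])
    have "?s (- int j - int m) = ?s (int j + int m)" for m
      using theta4_term_minus[of q "int j + int m"] by (simp add: algebra_simps)
    then show "((\<lambda>m. ?v m * (?s (int j - int m) - ?s (int j + int m))) has_sum g (int j) - g (- int j)) pos"
      using has_sum_diff[OF g[of "int j"] g[of "- int j"]] by (simp only: right_diff_distrib)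
  qed
  note sp = infsum_int_split[OF has_sum_imp_summable[OF S], of 0]
  have "?S = (\<Sum>\<^sub>\<infinity>m\<in>pos. of_int (0 + int m) * g (0 + int m)) + (\<Sum>\<^sub>\<infinity>m\<in>pos. of_int (0 - int m) * g (0 - int m))"
    using sp(1) infsumI[OF S] by simp
  also have "\<dots> = (\<Sum>\<^sub>\<infinity>m\<in>pos. of_int (0 + int m) * g (0 + int m) + of_int (0 - int m) * g (0 - int m))"
    by (rule infsum_add[symmetric]) (rule sp)+
  also have "\<dots> = (\<Sum>\<^sub>\<infinity>m\<in>pos. - (of_int (int m) ^ 2 * ?s (int m)))"
  proof (rule infsum_cong)
    fix m
    have "of_int (0 + int m) * g (0 + int m) + of_int (0 - int m) * g (0 - int m) = of_nat m * (g (int m) - g (- int m))"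
      by (simp add: algebra_simps)
    then show "of_int (0 + int m) * g (0 + int m) + of_int (0 - int m) * g (0 - int m) = - (of_int (int m) ^ 2 * ?s (int m))"
      unfolding gg by (simp add: power2_eq_square)
  qed
  also have "\<dots> = - (\<Sum>\<^sub>\<infinity>m\<in>pos. of_int (int m) ^ 2 * ?s (int m))"
    by (rule infsum_uminus)
  also have "2 * (\<Sum>\<^sub>\<infinity>m\<in>pos. of_int (int m) ^ 2 * ?s (int m)) = theta4 2 q"
    using infsum_int_split(1)[OF has_sum_imp_summable[OF theta4_has_sum[of 2]], of 0]
    by (simp add: theta4_def theta4_term_minus)
  then have "(\<Sum>\<^sub>\<infinity>m\<in>pos. of_int (int m) ^ 2 * ?s (int m)) = theta4 2 q / 2" by (simp add: field_simps)
  finally show ?thesis unfolding V_def by (simp add: field_simps)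
qed

end

subsection \<open>The quintuple product\<close>

text \<open>The class of 2 modulo 3 is parametrised as -1 - 3 k so that \<open>quint_minus\<close>
  reduces it to the class of 0.\<close>

lemma has_sum_int_mod3:
  fixes h :: "int \<Rightarrow> complex"
  assumes "(h has_sum S) UNIV"
  shows "(\<lambda>k. h (3 * k)) summable_on UNIV" "(\<lambda>k. h (3 * k + 1)) summable_on UNIV" "(\<lambda>k. h (- 1 - 3 * k)) summable_on UNIV"
    and "S = (\<Sum>\<^sub>\<infinity>k. h (3 * k)) + (\<Sum>\<^sub>\<infinity>k. h (3 * k + 1)) + (\<Sum>\<^sub>\<infinity>k. h (- 1 - 3 * k))"
proof -
  let ?A = "range (\<lambda>k::int. 3 * k)" and ?B = "range (\<lambda>k::int. 3 * k + 1)" and ?C = "range (\<lambda>k::int. - 1 - 3 * k)"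
  have s: "h summable_on ?A" "h summable_on ?B" "h summable_on ?C" "h summable_on (?B \<union> ?C)"
    by (rule summable_on_subset_banach[OF has_sum_imp_summable[OF assms]]; simp)+
  have inj: "inj (\<lambda>k::int. 3 * k)" "inj (\<lambda>k::int. 3 * k + 1)" "inj (\<lambda>k::int. - 1 - 3 * k)"
    by (auto simp: inj_on_def)
  show "(\<lambda>k. h (3 * k)) summable_on UNIV" "(\<lambda>k. h (3 * k + 1)) summable_on UNIV" "(\<lambda>k. h (- 1 - 3 * k)) summable_on UNIV"
    using s(1,2,3) summable_on_reindex[OF inj(1), of h] summable_on_reindex[OF inj(2), of h]
      summable_on_reindex[OF inj(3), of h] by (auto simp: o_def)
  have "x \<in> ?A \<union> (?B \<union> ?C)" for x :: int
  proof -
    have "x = 3 * (x div 3) + x mod 3" by simp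
    moreover have "x mod 3 = 0 \<or> x mod 3 = 1 \<or> x mod 3 = 2" by presburger
    ultimately have "x = 3 * (x div 3) \<or> x = 3 * (x div 3) + 1 \<or> x = - 1 - 3 * (- 1 - x div 3)" by presburger
    then show ?thesis by blast
  qed
  then have U: "(UNIV :: int set) = ?A \<union> (?B \<union> ?C)" by blast
  have disj: "?A \<inter> (?B \<union> ?C) = {}" "?B \<inter> ?C = {}"
    by (auto, presburger+)
  have "S = infsum h (?A \<union> (?B \<union> ?C))" using infsumI[OF assms] unfolding U[symmetric] by simp
  also have "\<dots> = infsum h ?A + (infsum h ?B + infsum h ?C)"
    by (simp only: infsum_Un_disjoint[OF s(1,4) disj(1)] infsum_Un_disjoint[OF s(2,3) disj(2)])
  finally show "S = (\<Sum>\<^sub>\<infinity>k. h (3 * k)) + (\<Sum>\<^sub>\<infinity>k. h (3 * k + 1)) + (\<Sum>\<^sub>\<infinity>k. h (- 1 - 3 * k))"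
    by (simp add: infsum_reindex[OF inj(1)] infsum_reindex[OF inj(2)] infsum_reindex[OF inj(3)] o_def)
qed

definition pent :: "int \<Rightarrow> nat" where "pent k = nat (k * (3 * k + 1) div 2)"

lemma int_pent: "2 * int (pent k) = k * (3 * k + 1)"
proof -
  have "0 \<le> k * (3 * k + 1)" by (cases "k \<ge> 0") (auto intro: mult_nonpos_nonpos)
  moreover have "even (k * (3 * k + 1))" by simp
  ultimately show ?thesis unfolding pent_def by simp
qed

lemma abs_le_pent: "nat \<bar>k\<bar> \<le> pent k"
proof -
  have "2 * \<bar>k\<bar> \<le> k * (3 * k + 1)"
  proof (cases "k \<ge> 0")
    case True
    then have "k \<le> k * k" by (cases "k = 0") auto
    with True show ?thesis by (simp add: algebra_simps)
  next
    case False
    then have "k * 1 \<ge> k * (- k)" by (intro mult_left_mono_neg) auto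
    with False show ?thesis by (simp add: algebra_simps)
  qed
  then show ?thesis using int_pent[of k] by linarith
qed

text \<open>Euler's pentagonal number series at q^2, known to equal the product of all 1 -
  q^(2n).\<close>

definition pent0 :: "complex \<Rightarrow> complex" where
  "pent0 q = (\<Sum>\<^sub>\<infinity>l. par l * q ^ (2 * pent l))"

text \<open>Coefficients of the product of the two theta series, regrouped along \<open>n = k + 2 l\<close>:
  this is the quintuple product identity up to the factor \<^const>\<open>pent0\<close>.\<close>

definition quint :: "complex \<Rightarrow> int \<Rightarrow> complex" where
  "quint q n = (\<Sum>\<^sub>\<infinity>l. theta1_term q (n - 2 * l) * theta4_term q l)"

lemma signed_power_eq2:
  fixes q :: complex
  assumes "a + e = c + d"
  shows "q ^ a * (x * y * q ^ e) = (x * q ^ c) * (y * q ^ d)"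
proof -
  have "q ^ a * (x * y * q ^ e) = x * y * (q ^ a * q ^ e)" by (simp only: mult_ac)
  also have "q ^ a * q ^ e = q ^ c * q ^ d" by (simp only: power_add[symmetric] assms)
  finally show ?thesis by (simp only: mult_ac)
qed

lemma quint_minus: "quint q (- 1 - n) = - quint q n"
proof -
  have "quint q (- 1 - n) = (\<Sum>\<^sub>\<infinity>l. - (theta1_term q (n - 2 * l) * theta4_term q l))"
    unfolding quint_def
  proof (rule infsum_reindex_bij_witness[where i = uminus and j = uminus])
    show "- (theta1_term q (n - 2 * (- l)) * theta4_term q (- l)) = theta1_term q (- 1 - n - 2 * l) * theta4_term q l" for l
      using theta1_term_minus[of q "n + 2 * l"] theta4_term_minus[of q l] by (simp add: algebra_simps)
  qed auto
  then show ?thesis by (simp add: infsum_uminus quint_def)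
qed

text \<open>Replacing l by k - l turns the exponent into \<open>pent k + 2 * pent l\<close>, so k
  and l separate.\<close>

lemma quint_0: "quint q (3 * k) = q ^ pent k * pent0 q"
proof -
  have "quint q (3 * k) = (\<Sum>\<^sub>\<infinity>l. q ^ pent k * (par l * q ^ (2 * pent l)))"
    unfolding quint_def
  proof (rule infsum_reindex_bij_witness[where i = "\<lambda>l. k - l" and j = "\<lambda>l. k - l"])
    fix l
    have "pent k + 2 * pent (k - l) = tri (3 * k - 2 * l) + sqn l"
      using int_pent[of k] int_pent[of "k - l"] int_tri[of "3 * k - 2 * l"] int_sqn[of l]
      by (simp add: algebra_simps)
    moreover have p: "par (k - l) = par (3 * k - 2 * l) * par l" unfolding par_def by auto
    ultimately show "q ^ pent k * (par (k - l) * q ^ (2 * pent (k - l))) = theta1_term q (3 * k - 2 * l) * theta4_term q l"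
      unfolding theta1_term_def theta4_term_def p by (intro signed_power_eq2)
  qed auto
  then show ?thesis by (simp add: infsum_cmult_right' pent0_def)
qed

text \<open>The exponent is quadratic in l and symmetric about k + 1/2. The reflection l -> 2 k + 1
  - l changes the parity of l, hence the sign, so the sum equals its own negative.\<close>

lemma quint_1: "quint q (3 * k + 1) = 0"
proof -
  have "quint q (3 * k + 1) = (\<Sum>\<^sub>\<infinity>l. - (theta1_term q (3 * k + 1 - 2 * l) * theta4_term q l))"
    unfolding quint_def
  proof (rule infsum_reindex_bij_witness[where i = "\<lambda>l. 2 * k + 1 - l" and j = "\<lambda>l. 2 * k + 1 - l"])
    fix l
    let ?l = "2 * k + 1 - l"
    have "tri (3 * k + 1 - 2 * ?l) + sqn ?l = tri (3 * k + 1 - 2 * l) + sqn l"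
      using int_tri[of "3 * k + 1 - 2 * ?l"] int_sqn[of ?l] int_tri[of "3 * k + 1 - 2 * l"] int_sqn[of l]
      by (simp add: algebra_simps)
    from signed_power_eq2[OF this, of q "par (3 * k + 1 - 2 * l)" "par l"]
    have "q ^ tri (3 * k + 1 - 2 * ?l) * (par (3 * k + 1 - 2 * l) * par l * q ^ sqn ?l)
      = theta1_term q (3 * k + 1 - 2 * l) * theta4_term q l" unfolding theta1_term_def theta4_term_def .
    moreover have "par (3 * k + 1 - 2 * l) * par l = - (par (3 * k + 1 - 2 * ?l) * par ?l)" unfolding par_def by auto
    ultimately have "q ^ tri (3 * k + 1 - 2 * ?l) * (- (par (3 * k + 1 - 2 * ?l) * par ?l) * q ^ sqn ?l)
      = theta1_term q (3 * k + 1 - 2 * l) * theta4_term q l" by (simp only:)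
    moreover have "- (x * y * (z * w)) = y * (- (x * z) * w)" for x y z w :: complex by (simp add: mult_ac)
    ultimately show "- (theta1_term q (3 * k + 1 - 2 * ?l) * theta4_term q ?l) = theta1_term q (3 * k + 1 - 2 * l) * theta4_term q l"
      unfolding theta1_term_def[of _ "3 * k + 1 - 2 * ?l"] theta4_term_def[of _ ?l] by (simp only:)
  qed auto
  then show ?thesis by (simp add: infsum_uminus quint_def)
qed

lemma epsilon_pent: "epsilon r q = (\<Sum>\<^sub>\<infinity>k. of_int (6 * k + 1) ^ r * q ^ pent k)"
  unfolding epsilon_def pent_def by simp

context
  fixes q :: complex
  assumes q: "norm q < 1"
begin

lemma pent0_summable: "(\<lambda>l. par l * q ^ (2 * pent l)) summable_on UNIV"
  by (rule tame_power_series_summable[OF tame_int q, where C = 1 and d = 0]) (simp_all add: order_trans[OF abs_le_pent])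

text \<open>Along n = k + 2 l the weight is 2 n + 1, which is 6 k + 1 at n = 3 k and -(6 k + 1) at n
  = -1 - 3 k, where \<open>quint\<close> changes sign too. For odd r both classes contribute
  equally, whence the 2.\<close>

lemma quint_moment:
  assumes r: "odd r"
    and hs: "((\<lambda>(k, l). of_int (2 * (k + 2 * l) + 1) ^ r * (theta1_term q k * theta4_term q l)) has_sum S) (UNIV \<times> UNIV)"
  shows "S = 2 * pent0 q * epsilon r q"
proof -
  note hs
  also have "((\<lambda>(k, l). of_int (2 * (k + 2 * l) + 1) ^ r * (theta1_term q k * theta4_term q l)) has_sum S) (UNIV \<times> UNIV) \<longleftrightarrow>
      ((\<lambda>(n, l). of_int (2 * n + 1) ^ r * (theta1_term q (n - 2 * l) * theta4_term q l)) has_sum S) (UNIV \<times> UNIV)"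
    by (rule has_sum_reindex_bij_witness[where i = "\<lambda>(n, l). (n - 2 * l, l)" and j = "\<lambda>(k, l). (k + 2 * l, l)"]) auto
  finally have *: "((\<lambda>(n, l). of_int (2 * n + 1) ^ r * (theta1_term q (n - 2 * l) * theta4_term q l)) has_sum S) (UNIV \<times> UNIV)" .
  have b: "norm (theta1_term q k) \<le> 1" for k
    unfolding theta1_term_def norm_mult norm_power using q by (simp add: power_le_one)
  have s: "((\<lambda>l. theta1_term q (n - 2 * l) * theta4_term q l) has_sum quint q n) UNIV" for n
    unfolding quint_def
    by (intro has_sum_infsum summable_on_bounded_mult[where K = 1] b) (use theta4_term_summable[OF q, of 0 1 0] in simp)
  have "((\<lambda>n. of_int (2 * n + 1) ^ r * quint q n) has_sum S) UNIV"
    by (rule has_sum_SigmaD[OF *], simp only: prod.case, rule has_sum_cmult_right[OF s])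
  note sp = has_sum_int_mod3[OF this]
  have 0: "of_int (2 * (3 * k) + 1) ^ r * quint q (3 * k) = pent0 q * (of_int (6 * k + 1) ^ r * q ^ pent k)" for k
    unfolding quint_0 by (simp add: algebra_simps)
  have 2: "of_int (2 * (- 1 - 3 * k) + 1) ^ r * quint q (- 1 - 3 * k) = pent0 q * (of_int (6 * k + 1) ^ r * q ^ pent k)" for k
  proof -
    have "of_int (2 * (- 1 - 3 * k) + 1) = - (of_int (6 * k + 1) :: complex)" by simp
    then have "of_int (2 * (- 1 - 3 * k) + 1) ^ r = - (of_int (6 * k + 1) ^ r :: complex)"
      using power_minus_odd[OF r] by (simp only:)
    then show ?thesis unfolding quint_minus quint_0 by (simp only: minus_mult_minus mult_ac)
  qed
  show ?thesis
    unfolding sp(4) 0 2 quint_1 by (simp add: infsum_cmult_right' epsilon_pent)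
qed

lemma pent0_epsilon: "pent0 q * (epsilon 3 q - (9 * P_series q - 8 * E_series q) * epsilon 1 q) = 0"
proof -
  note T = has_sum_times[OF theta1_has_sum[OF q] theta4_has_sum[OF q]]
  have "((\<lambda>(k, l). of_int (2 * (k + 2 * l) + 1) ^ 1 * (theta1_term q k * theta4_term q l)) has_sum theta1 1 q * theta4 0 q) (UNIV \<times> UNIV)"
    using has_sum_add[OF T[of 1 0] has_sum_cmult_right[OF T[of 0 1], of 4]]
    by (simp add: theta1_even[OF q] case_prod_unfold algebra_simps)
  from quint_moment[OF _ this] have 1: "theta1 1 q * theta4 0 q = 2 * pent0 q * epsilon 1 q" by simp
  \<comment> \<open>With x = 2 k + 1 the weight is (x + 4 l)^3; odd powers of x and even powers of l
    survive, that is x^3 + 48 x l^2.\<close>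
  have "((\<lambda>(k, l). of_int (2 * (k + 2 * l) + 1) ^ 3 * (theta1_term q k * theta4_term q l)) has_sum
      theta1 3 q * theta4 0 q + 48 * (theta1 1 q * theta4 2 q)) (UNIV \<times> UNIV)"
    using has_sum_add[OF has_sum_add[OF T[of 3 0] has_sum_cmult_right[OF T[of 2 1], of 12]]
      has_sum_add[OF has_sum_cmult_right[OF T[of 1 2], of 48] has_sum_cmult_right[OF T[of 0 3], of 64]]]
    by (simp add: theta1_even[OF q] case_prod_unfold algebra_simps eval_nat_numeral)
  from quint_moment[OF _ this]
  have "theta1 3 q * theta4 0 q + 48 * (theta1 1 q * theta4 2 q) = 2 * pent0 q * epsilon 3 q" by simp
  \<comment> \<open>The factor is (1 - 24 A) - 24 (3 A - B) for the unsigned and signed first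
    Lambert series A and B; in terms of P and E it is 9 P - 8 E.\<close>
  moreover have "theta1 3 q * theta4 0 q + 48 * (theta1 1 q * theta4 2 q)
      = (theta1 1 q * theta4 0 q) * (1 - 96 * lambert 1 1 q + 24 * lambert (- 1) 1 q)"
    unfolding theta1_ratio[OF q] theta4_ratio[OF q] by (simp add: field_simps)
  ultimately have "2 * pent0 q * epsilon 3 q = 2 * pent0 q * epsilon 1 q * (1 - 96 * lambert 1 1 q + 24 * lambert (- 1) 1 q)"
    unfolding 1 by simp
  then show ?thesis
    unfolding P_series_lambert[OF q] E_series_lambert[OF q] by algebra
qed

end

section \<open>Holomorphy and the Euler operator on the moments\<close>

lemma pent0_holomorphic: "pent0 holomorphic_on ball 0 1"
  unfolding pent0_def by (rule series_holomorphic[OF pent0_summable])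

lemma pent_eq_0_iff [simp]: "pent k = 0 \<longleftrightarrow> k = 0"
  using abs_le_pent[of k] by (auto simp: pent_def)

lemma pent_0 [simp]: "pent 0 = 0"
  by (simp add: pent_def)

lemma infsum_power_0:
  assumes "m \<ge> 1"
  shows "(\<Sum>\<^sub>\<infinity>k. c k * (0 :: complex) ^ (m * pent k)) = c 0"
proof -
  have "(\<Sum>\<^sub>\<infinity>k. c k * (0 :: complex) ^ (m * pent k)) = (\<Sum>\<^sub>\<infinity>k\<in>{0}. c k * 0 ^ (m * pent k))"
    by (rule infsum_cong_neutral) (use assms in auto)
  then show ?thesis by simp
qed

lemma epsilon_summable:
  fixes q :: complex
  assumes "norm q < 1"
  shows "(\<lambda>k. of_int (6 * k + 1) ^ r * q ^ pent k) summable_on UNIV"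
proof (rule tame_power_series_summable[OF tame_int assms, where C = "6 ^ r" and d = r])
  fix k
  have "norm (of_int (6 * k + 1) :: complex) \<le> 6 * (1 + real (nat \<bar>k\<bar>))"
  proof -
    have "real_of_int \<bar>6 * k + 1\<bar> \<le> real_of_int (6 * (1 + \<bar>k\<bar>))" unfolding of_int_le_iff by (cases "k \<ge> 0") auto
    then show ?thesis unfolding norm_of_int by simp
  qed
  then have "norm (of_int (6 * k + 1) :: complex) ^ r \<le> (6 * (1 + real (nat \<bar>k\<bar>))) ^ r"
    by (intro power_mono) auto
  then show "norm (of_int (6 * k + 1) ^ r :: complex) \<le> 6 ^ r * (1 + real (nat \<bar>k\<bar>)) ^ r"
    by (simp only: norm_power power_mult_distrib)
  show "nat \<bar>k\<bar> \<le> 2 * pent k + 1" using abs_le_pent[of k] by simp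
qed

lemma epsilon_holomorphic: "epsilon r holomorphic_on ball 0 1"
  unfolding epsilon_pent[abs_def] by (rule series_holomorphic[OF epsilon_summable])

lemma epsilon_Suc_Suc:
  assumes q: "norm q < 1"
  shows "epsilon (r + 2) q = epsilon r q + 24 * (q * deriv (epsilon r) q)"
proof -
  have e: "((\<lambda>k. of_int (6 * k + 1) ^ r * q ^ pent k) has_sum epsilon r q) UNIV"
    unfolding epsilon_pent by (intro has_sum_infsum epsilon_summable q)
  have "((\<lambda>k. of_int (6 * k + 1) ^ r * of_nat (pent k) * q ^ pent k) has_sum q * deriv (epsilon r) q) UNIV"
    unfolding epsilon_pent[abs_def] by (rule series_euler_deriv[OF epsilon_summable q])
  from has_sum_add[OF e has_sum_cmult_right[OF this, of 24]]
  have "((\<lambda>k. of_int (6 * k + 1) ^ (r + 2) * q ^ pent k) has_sum epsilon r q + 24 * (q * deriv (epsilon r) q)) UNIV"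
  proof (rule iffD1[OF has_sum_cong, rotated])
    fix k
    let ?x = "of_int (6 * k + 1) :: complex" and ?p = "of_nat (pent k) :: complex"
    have "of_int (24 * int (pent k)) = (of_int (12 * (k * (3 * k + 1))) :: complex)"
      unfolding int_pent[symmetric] by simp
    then have p: "1 + 24 * ?p = ?x ^ 2"
      by (simp add: power2_eq_square algebra_simps)
    have "?x ^ r * q ^ pent k + 24 * (?x ^ r * ?p * q ^ pent k) = ?x ^ r * (1 + 24 * ?p) * q ^ pent k"
      by (simp only: distrib_left distrib_right mult_1_right mult_1_left mult_ac)
    then show "?x ^ r * q ^ pent k + 24 * (?x ^ r * ?p * q ^ pent k) = ?x ^ (r + 2) * q ^ pent k"
      unfolding p power_add .
  qed
  then show ?thesis unfolding epsilon_pent[of "r + 2"] by (rule infsumI)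
qed

subsection \<open>The quotients by the first moment\<close>

lemma
  shows P_series_holomorphic: "P_series holomorphic_on ball 0 1"
    and E_series_holomorphic: "E_series holomorphic_on ball 0 1"
proof -
  have "\<exists>D. (P_series has_field_derivative D) (at q)" "\<exists>D. (E_series has_field_derivative D) (at q)"
    if "q \<in> ball 0 1" for q
    using P_series_deriv[of q] E_series_deriv[of q] that by (metis mem_ball_0)+
  then show "P_series holomorphic_on ball 0 1" "E_series holomorphic_on ball 0 1"
    by (auto simp: holomorphic_on_open)
qed

definition eps_ratio :: "complex \<Rightarrow> complex" where
  "eps_ratio q = 9 * P_series q - 8 * E_series q"

lemma eps_ratio_holomorphic: "eps_ratio holomorphic_on ball 0 1"
  unfolding eps_ratio_def[abs_def]
  by (intro holomorphic_intros P_series_holomorphic E_series_holomorphic)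

lemma epsilon_3:
  assumes q: "norm q < 1"
  shows "epsilon 3 q = eps_ratio q * epsilon 1 q"
proof -
  let ?g = "\<lambda>q. epsilon 3 q - eps_ratio q * epsilon 1 q"
  have "pent0 0 = 1"
    using infsum_power_0[of 2 par] by (simp add: pent0_def)
  moreover have "isCont pent0 0"
    using holomorphic_on_imp_continuous_on[OF pent0_holomorphic] by (simp add: continuous_on_eq_continuous_at)
  ultimately obtain d where d: "d > 0" "\<And>z. dist 0 z < d \<Longrightarrow> pent0 z \<noteq> 0"
    using continuous_at_avoid[of 0 pent0 0] by auto
  have "?g q = 0"
  proof (rule analytic_continuation[of ?g "ball 0 1" "ball 0 (min d 1)" 0])
    show "?g holomorphic_on ball 0 1"
      by (intro holomorphic_intros epsilon_holomorphic eps_ratio_holomorphic)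
    show "0 islimpt ball (0::complex) (min d 1)"
      using d(1) by (intro interior_limit_point) (simp add: interior_open)
    show "?g z = 0" if "z \<in> ball 0 (min d 1)" for z
      using pent0_epsilon[of z] d(2)[of z] that by (simp add: eps_ratio_def)
  qed (use q in auto)
  then show ?thesis by simp
qed

lemma epsilon_1_euler_deriv:
  assumes "norm q < 1"
  shows "24 * (q * deriv (epsilon 1) q) = (eps_ratio q - 1) * epsilon 1 q"
  using epsilon_Suc_Suc[OF assms, of 1] epsilon_3[OF assms] by (simp add: algebra_simps eval_nat_numeral)

lemma epsilon_has_derivative:
  assumes "norm q < 1"
  shows "(epsilon r has_field_derivative deriv (epsilon r) q) (at q)"
  using epsilon_holomorphic assms by (intro holomorphic_derivI[of _ "ball 0 1"]) auto

lemma lambert_at_0: "lambert x s 0 = 0"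
proof -
  have "lambert x s 0 = (\<Sum>\<^sub>\<infinity>p\<in>pos \<times> pos. 0)"
    unfolding lambert_def by (rule infsum_cong) auto
  then show ?thesis by simp
qed

text \<open>The equation \<open>24 q \<epsilon>\<^sub>1' = (9 P - 8 E - 1) \<epsilon>\<^sub>1\<close> is regular at \<open>0\<close>, so its solution is
  an exponential.\<close>

lemma epsilon_1_nonzero:
  assumes q: "norm q < 1"
  shows "epsilon 1 q \<noteq> 0"
proof -
  have r0: "eps_ratio 0 = 1"
    by (simp add: eps_ratio_def P_series_lambert E_series_lambert lambert_at_0)
  \<comment> \<open>Because \<open>eps_ratio 0 = 1\<close>, this is (\<open>eps_ratio z\<close> - 1)
    / z filled in at 0. For a primitive H of it, exp (H / 24) is the candidate for
    \<open>epsilon 1\<close>, and F is the quotient of the two.\<close>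
  define G where "G = (\<lambda>z. if z = 0 then deriv eps_ratio 0 else (eps_ratio z - eps_ratio 0) / (z - 0))"
  have "G holomorphic_on ball 0 1"
    unfolding G_def by (rule pole_lemma[OF eps_ratio_holomorphic]) simp
  then obtain H where H: "\<And>z. z \<in> ball 0 1 \<Longrightarrow> (H has_field_derivative G z) (at z within ball 0 1)"
    using holomorphic_convex_primitive'[of "ball 0 1" G] by auto
  have H': "(H has_field_derivative G z) (at z)" if "norm z < 1" for z
    using H[of z] that by (simp add: at_within_open[of z "ball 0 1"])
  define F where "F z = epsilon 1 z * exp (- H z / 24)" for z
  have F': "(F has_field_derivative (deriv (epsilon 1) z - epsilon 1 z * G z / 24) * exp (- H z / 24)) (at z)"
    if "norm z < 1" for z
    unfolding F_def[abs_def] using that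
    by (auto intro!: derivative_eq_intros epsilon_has_derivative H' simp: field_simps)
  obtain c where c: "\<And>z. z \<in> ball 0 1 \<Longrightarrow> F z = c"
  proof (rule DERIV_zero_connected_constant[of "ball 0 1" "{0}" F])
    show "continuous_on (ball 0 1) F"
    proof (intro continuous_at_imp_continuous_on ballI)
      show "isCont F z" if "z \<in> ball 0 1" for z
        using DERIV_isCont[OF F'[of z]] that by simp
    qed
    \<comment> \<open>At z = 0 an equation for z d/dz says nothing about the derivative, so 0 is
      excepted and bridged by continuity.\<close>
    show "\<forall>z\<in>ball 0 1 - {0}. (F has_field_derivative 0) (at z)"
    proof
      fix z :: complex assume z: "z \<in> ball 0 1 - {0}"
      then have "24 * deriv (epsilon 1) z = epsilon 1 z * G z"
        using epsilon_1_euler_deriv[of z] by (simp add: G_def r0 field_simps)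
      then have 0: "deriv (epsilon 1) z - epsilon 1 z * G z / 24 = 0" by (simp add: field_simps)
      have "norm z < 1" using z by simp
      from F'[OF this, unfolded 0] show "(F has_field_derivative 0) (at z)" by simp
    qed
  qed auto
  have "epsilon 1 0 = 1"
    using infsum_power_0[of 1 "\<lambda>k. of_int (6 * k + 1)"] by (simp add: epsilon_pent)
  then have "F 0 \<noteq> 0" by (simp add: F_def)
  moreover have "F q = F 0" using c[of q] c[of 0] q by simp
  ultimately show ?thesis by (auto simp: F_def)
qed

text \<open>The guard \<open>c \<noteq> 0\<close> absorbs the truncated exponents \<open>i - 1\<close> and \<open>j - 1\<close> at \<open>0\<close> in the
  derivative of a monomial.\<close>

inductive weighted :: "nat \<Rightarrow> (complex \<Rightarrow> complex) \<Rightarrow> bool" where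
  zero: "weighted n (\<lambda>_. 0)"
| step: "weighted n f \<Longrightarrow> (c \<noteq> 0 \<Longrightarrow> i + j + 2 * k = n) \<Longrightarrow>
    weighted n (\<lambda>q. f q + of_int c * (P_series q ^ i * E_series q ^ j * Q_series q ^ k))"

lemma weighted_add: "weighted n g \<Longrightarrow> weighted n f \<Longrightarrow> weighted n (\<lambda>q. f q + g q)"
proof (induction rule: weighted.induct)
  case (step n g c i j k)
  then show ?case
    using weighted.step[of n "\<lambda>q. f q + g q" c i j k] by (simp add: add.assoc)
qed simp

text \<open>The rearrangement is formal, by induction on how f is built, so one K serves every q;
  this is where independence of q comes from.\<close>

lemma weighted_sum_representation:
  assumes "weighted n f"
  shows "\<exists>K :: nat \<Rightarrow> nat \<Rightarrow> nat \<Rightarrow> nat \<Rightarrow> int. \<forall>q. f q =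
    (\<Sum>(i, j, k, l) \<in> {(i, j, k, l). 2 * i + 2 * j + 4 * k + 6 * l = 2 * n}.
      of_int (K i j k l) * P_series q ^ i * E_series q ^ j * Q_series q ^ k * R_series q ^ l)"
  using assms
proof (induction rule: weighted.induct)
  case (zero n)
  show ?case by (intro exI[of _ "\<lambda>_ _ _ _. 0"]) (simp add: case_prod_unfold)
next
  case (step n f c i j k)
  let ?I = "{(i, j, k, l). 2 * i + 2 * j + 4 * k + 6 * l = 2 * (n :: nat)}"
  have "?I \<subseteq> {..n} \<times> {..n} \<times> {..n} \<times> {..n}" by auto
  then have fin: "finite ?I" by (rule finite_subset) simp
  from step.IH obtain K where K: "\<And>q. f q = (\<Sum>(i, j, k, l) \<in> ?I.
      of_int (K i j k l) * P_series q ^ i * E_series q ^ j * Q_series q ^ k * R_series q ^ l)" by blast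
  show ?case
  proof (cases "c = 0")
    \<comment> \<open>For c = 0 the exponents are unconstrained and (i, j, k, 0) may lie outside
      \<open>?I\<close>, so the old K is kept.\<close>
    case True
    with K show ?thesis by auto
  next
    case False
    with step.hyps have mem: "(i, j, k, 0) \<in> ?I" by auto
    define K' where "K' a b d l = K a b d l + (if (a, b, d, l) = (i, j, k, 0) then c else 0)" for a b d l
    have "f q + of_int c * (P_series q ^ i * E_series q ^ j * Q_series q ^ k) = (\<Sum>(a, b, d, l) \<in> ?I.
      of_int (K' a b d l) * P_series q ^ a * E_series q ^ b * Q_series q ^ d * R_series q ^ l)" for q
    proof -
      have "(\<Sum>(a, b, d, l) \<in> ?I. of_int (K' a b d l) * P_series q ^ a * E_series q ^ b * Q_series q ^ d * R_series q ^ l)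
        = (\<Sum>p \<in> ?I. (case p of (a, b, d, l) \<Rightarrow> of_int (K a b d l) * P_series q ^ a * E_series q ^ b * Q_series q ^ d * R_series q ^ l)
          + (if p = (i, j, k, 0) then of_int c * (P_series q ^ i * E_series q ^ j * Q_series q ^ k) else 0))"
      proof (rule sum.cong[OF refl])
        fix p :: "nat \<times> nat \<times> nat \<times> nat"
        obtain a b d l where p: "p = (a, b, d, l)" by (cases p) auto
        show "(case p of (a, b, d, l) \<Rightarrow> of_int (K' a b d l) * P_series q ^ a * E_series q ^ b * Q_series q ^ d * R_series q ^ l)
          = (case p of (a, b, d, l) \<Rightarrow> of_int (K a b d l) * P_series q ^ a * E_series q ^ b * Q_series q ^ d * R_series q ^ l)
          + (if p = (i, j, k, 0) then of_int c * (P_series q ^ i * E_series q ^ j * Q_series q ^ k) else 0)"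
          unfolding p K'_def by (cases "(a, b, d, l) = (i, j, k, 0)") (auto simp: distrib_right mult.assoc)
      qed
      also have "\<dots> = f q + of_int c * (P_series q ^ i * E_series q ^ j * Q_series q ^ k)"
        unfolding sum.distrib K using mem by (simp add: sum.delta[OF fin])
      finally show ?thesis by simp
    qed
    then show ?thesis by blast
  qed
qed

lemma monomial_deriv:
  fixes c :: int and i j k :: nat
  assumes n: "c \<noteq> 0 \<Longrightarrow> i + j + 2 * k = n"
  defines "M \<equiv> \<lambda>q. of_int c * (P_series q ^ i * E_series q ^ j * Q_series q ^ k)"
  shows "\<exists>g. weighted (Suc n) g \<and> (\<forall>q. norm q < 1 \<longrightarrow>
    (\<exists>D. (M has_field_derivative D) (at q) \<and> 24 * (q * D) + eps_ratio q * M q = g q))"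
proof -
  define m where "m a b d = (\<lambda>q. P_series q ^ a * E_series q ^ b * Q_series q ^ d)" for a b d
  \<comment> \<open>The constants come from 24 D P = 6 (P^2 - Q), 24 D E = 12 (P E - Q), 24 D Q = 24
    Q (P - E) and the multiplier 9 P - 8 E. The leading 0 is the base case of
    \<open>weighted\<close>.\<close>
  define g where "g = (\<lambda>q. 0 + of_int (c * (6 * int i + 12 * int j + 24 * int k + 9)) * m (Suc i) j k q
    + of_int (- c * (24 * int k + 8)) * m i (Suc j) k q
    + of_int (- 6 * c * int i) * m (i - 1) j (Suc k) q
    + of_int (- 12 * c * int j) * m i (j - 1) (Suc k) q)"
  have "weighted (Suc n) g"
    unfolding g_def m_def by (intro weighted.intros) (use n in auto)
  moreover have "\<exists>D. (M has_field_derivative D) (at q) \<and> 24 * (q * D) + eps_ratio q * M q = g q" if q: "norm q < 1" for q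
  proof -
    define P E Q where PEQ: "P = P_series q" "E = E_series q" "Q = Q_series q"
    obtain P' E' Q' where der: "(P_series has_field_derivative P') (at q)" "(E_series has_field_derivative E') (at q)"
        "(Q_series has_field_derivative Q') (at q)"
      and eq: "4 * (q * P') = P ^ 2 - Q" "2 * (q * E') = P * E - Q" "q * Q' = Q * (P - E)"
      using P_series_deriv[OF q] E_series_deriv[OF q] Q_series_deriv[OF q] unfolding PEQ by metis
    define D where "D = of_int c * (of_nat i * P ^ (i - 1) * P' * E ^ j * Q ^ k
      + P ^ i * (of_nat j * E ^ (j - 1) * E') * Q ^ k + P ^ i * E ^ j * (of_nat k * Q ^ (k - 1) * Q'))"
    have "(M has_field_derivative D) (at q)"
      unfolding M_def D_def PEQ
      by (auto intro!: derivative_eq_intros der simp: algebra_simps)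
    moreover have "24 * (q * D) + eps_ratio q * M q = g q"
    proof -
      have "of_nat i * P ^ (i - 1) * (24 * (q * P')) = of_nat i * P ^ (i - 1) * (6 * (4 * (q * P')))" by simp
      then have 1: "of_nat i * P ^ (i - 1) * (24 * (q * P')) = 6 * of_nat i * P ^ Suc i - 6 * of_nat i * P ^ (i - 1) * Q"
        unfolding eq by (cases i) (simp_all add: algebra_simps power2_eq_square)
      have "of_nat j * E ^ (j - 1) * (24 * (q * E')) = of_nat j * E ^ (j - 1) * (12 * (2 * (q * E')))" by simp
      then have 2: "of_nat j * E ^ (j - 1) * (24 * (q * E')) = 12 * of_nat j * P * E ^ j - 12 * of_nat j * E ^ (j - 1) * Q"
        unfolding eq by (cases j) (simp_all add: algebra_simps)
      have 3: "of_nat k * Q ^ (k - 1) * (24 * (q * Q')) = 24 * of_nat k * Q ^ k * (P - E)"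
        unfolding eq by (cases k) (simp_all add: algebra_simps)
      have "24 * (q * D) = of_int c * ((of_nat i * P ^ (i - 1) * (24 * (q * P'))) * E ^ j * Q ^ k
        + P ^ i * (of_nat j * E ^ (j - 1) * (24 * (q * E'))) * Q ^ k + P ^ i * E ^ j * (of_nat k * Q ^ (k - 1) * (24 * (q * Q'))))"
        unfolding D_def by (simp add: algebra_simps)
      then show ?thesis
        unfolding 1 2 3 g_def m_def M_def eps_ratio_def PEQ[symmetric] by (simp add: algebra_simps)
    qed
    ultimately show ?thesis by blast
  qed
  ultimately show ?thesis by blast
qed

lemma weighted_deriv:
  assumes "weighted n f"
  shows "\<exists>g. weighted (Suc n) g \<and> (\<forall>q. norm q < 1 \<longrightarrow>
    (\<exists>D. (f has_field_derivative D) (at q) \<and> 24 * (q * D) + eps_ratio q * f q = g q))"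
  using assms
proof (induction rule: weighted.induct)
  case (zero n)
  show ?case
    by (intro exI[of _ "\<lambda>_. 0"] conjI weighted.zero allI impI exI[of _ "0 :: complex"] DERIV_const) simp
next
  case (step n f c i j k)
  from step.IH obtain g where g: "weighted (Suc n) g" "\<And>q. norm q < 1 \<Longrightarrow>
    \<exists>D. (f has_field_derivative D) (at q) \<and> 24 * (q * D) + eps_ratio q * f q = g q" by blast
  let ?M = "\<lambda>q. of_int c * (P_series q ^ i * E_series q ^ j * Q_series q ^ k)"
  from monomial_deriv[OF step.hyps(2)] obtain h where h: "weighted (Suc n) h" "\<And>q. norm q < 1 \<Longrightarrow>
    \<exists>D. (?M has_field_derivative D) (at q) \<and> 24 * (q * D) + eps_ratio q * ?M q = h q" by blast
  show ?case
  proof (intro exI[of _ "\<lambda>q. g q + h q"] conjI allI impI)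
    show "weighted (Suc n) (\<lambda>q. g q + h q)" by (rule weighted_add[OF h(1) g(1)])
    fix q :: complex assume q: "norm q < 1"
    obtain D D' where D: "(f has_field_derivative D) (at q)" "24 * (q * D) + eps_ratio q * f q = g q"
      "(?M has_field_derivative D') (at q)" "24 * (q * D') + eps_ratio q * ?M q = h q"
      using g(2)[OF q] h(2)[OF q] by blast
    have "((\<lambda>q. f q + ?M q) has_field_derivative D + D') (at q)" by (rule DERIV_add[OF D(1,3)])
    moreover have "24 * (q * (D + D')) + eps_ratio q * (f q + ?M q) = g q + h q"
      unfolding D(2,4)[symmetric] by (simp only: distrib_left add_ac)
    ultimately show "\<exists>D. ((\<lambda>q. f q + ?M q) has_field_derivative D) (at q) \<and>
        24 * (q * D) + eps_ratio q * (f q + ?M q) = g q + h q" by blast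
  qed
qed

text \<open>Product rule for 24 D + 1 on \<open>f * epsilon 1\<close>: since 24 D
  \<open>epsilon 1\<close> is (\<open>eps_ratio\<close> - 1) \<open>epsilon 1\<close>, the summand f
  cancels against -f.\<close>

lemma epsilon_step:
  assumes q: "norm q < 1" and f: "\<And>z. norm z < 1 \<Longrightarrow> epsilon r z = f z * epsilon 1 z"
    and D: "(f has_field_derivative D) (at q)"
  shows "epsilon (r + 2) q = (24 * (q * D) + eps_ratio q * f q) * epsilon 1 q"
proof -
  have "((\<lambda>z. f z * epsilon 1 z) has_field_derivative D * epsilon 1 q + f q * deriv (epsilon 1) q) (at q)"
    using D epsilon_has_derivative[OF q, of 1] by (auto intro!: derivative_eq_intros)
  from deriv_ball_cong[OF q this f] have "deriv (epsilon r) q = D * epsilon 1 q + f q * deriv (epsilon 1) q"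
    by (rule DERIV_imp_deriv)
  then have "epsilon (r + 2) q = f q * epsilon 1 q + 24 * (q * D) * epsilon 1 q + f q * (24 * (q * deriv (epsilon 1) q))"
    using epsilon_Suc_Suc[OF q, of r] f[OF q] by (simp add: algebra_simps)
  then show ?thesis unfolding epsilon_1_euler_deriv[OF q] by (simp add: algebra_simps)
qed

lemma epsilon_weighted: "\<exists>f. weighted n f \<and> (\<forall>q. norm q < 1 \<longrightarrow> epsilon (2 * n + 1) q = f q * epsilon 1 q)"
proof (induction n)
  case 0
  \<comment> \<open>The constant 1 has to be presented as 0 plus the empty monomial to match the
    rule \<open>step\<close>.\<close>
  have "weighted 0 (\<lambda>q. 0 + of_int 1 * (P_series q ^ 0 * E_series q ^ 0 * Q_series q ^ 0))"
    by (intro weighted.intros) simp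
  then show ?case by (intro exI[of _ "\<lambda>_. 1"]) simp
next
  case (Suc n)
  then obtain f where f: "weighted n f" "\<And>q. norm q < 1 \<Longrightarrow> epsilon (2 * n + 1) q = f q * epsilon 1 q" by blast
  from weighted_deriv[OF f(1)] obtain g where g: "weighted (Suc n) g" "\<And>q. norm q < 1 \<Longrightarrow>
    \<exists>D. (f has_field_derivative D) (at q) \<and> 24 * (q * D) + eps_ratio q * f q = g q" by blast
  have "epsilon (2 * Suc n + 1) q = g q * epsilon 1 q" if "norm q < 1" for q
    using g(2)[OF that] epsilon_step[OF that f(2)] by (auto simp: numeral_2_eq_2)
  with g(1) show ?case by blast
qed

lemma epsilon_5:
  assumes q: "norm q < 1"
  shows "epsilon 5 q = (135 * P_series q ^ 2 - 240 * P_series q * E_series q + 64 * E_series q ^ 2 + 42 * Q_series q) * epsilon 1 q"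
proof -
  obtain P' E' where der: "(P_series has_field_derivative P') (at q)" "(E_series has_field_derivative E') (at q)"
    and eq: "4 * (q * P') = P_series q ^ 2 - Q_series q" "2 * (q * E') = P_series q * E_series q - Q_series q"
    using P_series_deriv[OF q] E_series_deriv[OF q] by metis
  have "(eps_ratio has_field_derivative 9 * P' - 8 * E') (at q)"
    unfolding eps_ratio_def[abs_def] by (auto intro!: derivative_eq_intros der)
  from epsilon_step[OF q epsilon_3 this]
  have "epsilon 5 q = (24 * (q * (9 * P' - 8 * E')) + eps_ratio q * eps_ratio q) * epsilon 1 q" by simp
  \<comment> \<open>Here 54 = 24 * 9 / 4 and 96 = 24 * 8 / 2, fitting the factors 4 and 2 in the
    equations for P and E.\<close>
  also have "24 * (q * (9 * P' - 8 * E')) = 54 * (4 * (q * P')) - 96 * (2 * (q * E'))" by (simp add: algebra_simps)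
  finally show ?thesis unfolding eq eps_ratio_def by (simp add: algebra_simps power2_eq_square)
qed

theorem theorem2p15:
  "(\<forall>q :: complex. norm q < 1 \<longrightarrow>
      epsilon 3 q / epsilon 1 q = 9 * P_series q - 8 * E_series q \<and>
      epsilon 5 q / epsilon 1 q =
        135 * P_series q ^ 2 - 240 * P_series q * E_series q + 64 * E_series q ^ 2 + 42 * Q_series q) \<and>
   (\<forall>n :: nat. \<exists>K :: nat \<Rightarrow> nat \<Rightarrow> nat \<Rightarrow> nat \<Rightarrow> int. \<forall>q :: complex. norm q < 1 \<longrightarrow>
      epsilon (2 * n + 1) q / epsilon 1 q =
        (\<Sum>(i, j, k, l) \<in> {(i, j, k, l). 2 * i + 2 * j + 4 * k + 6 * l = 2 * n}.
           of_int (K i j k l) * P_series q ^ i * E_series q ^ j * Q_series q ^ k * R_series q ^ l))"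
proof (intro conjI allI impI)
  fix q :: complex assume q: "norm q < 1"
  show "epsilon 3 q / epsilon 1 q = 9 * P_series q - 8 * E_series q"
    using epsilon_3[OF q] epsilon_1_nonzero[OF q] by (simp add: eps_ratio_def)
  show "epsilon 5 q / epsilon 1 q =
      135 * P_series q ^ 2 - 240 * P_series q * E_series q + 64 * E_series q ^ 2 + 42 * Q_series q"
    using epsilon_5[OF q] epsilon_1_nonzero[OF q] by simp
next
  fix n
  obtain f where f: "weighted n f" "\<And>q. norm q < 1 \<Longrightarrow> epsilon (2 * n + 1) q = f q * epsilon 1 q"
    using epsilon_weighted by blast
  then have eq: "epsilon (2 * n + 1) q / epsilon 1 q = f q" if "norm q < 1" for q
    using that epsilon_1_nonzero[OF that] by simp
  obtain K where K: "\<And>q. f q = (\<Sum>(i, j, k, l) \<in> {(i, j, k, l). 2 * i + 2 * j + 4 * k + 6 * l = 2 * n}.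
      of_int (K i j k l) * P_series q ^ i * E_series q ^ j * Q_series q ^ k * R_series q ^ l)"
    using weighted_sum_representation[OF f(1)] by blast
  show "\<exists>K :: nat \<Rightarrow> nat \<Rightarrow> nat \<Rightarrow> nat \<Rightarrow> int. \<forall>q :: complex. norm q < 1 \<longrightarrow>
      epsilon (2 * n + 1) q / epsilon 1 q =
        (\<Sum>(i, j, k, l) \<in> {(i, j, k, l). 2 * i + 2 * j + 4 * k + 6 * l = 2 * n}.
           of_int (K i j k l) * P_series q ^ i * E_series q ^ j * Q_series q ^ k * R_series q ^ l)"
    by (intro exI[of _ K] allI impI) (simp only: eq K)
qed

end
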